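(* There is a constant $c$ such that for all binary strings $a,b$, \[ \bigl|\, C(a,b) - \bigl( K(a \mid C(a,b)) + C(b \mid a, C(a,b)) \bigr) \bigr| \le c . \]
   Context: $C(u)$ denotes plain Kolmogorov complexity (the minimal length of a program producing $u$ on a fixed optimal universal machine) and $C(u\mid v)$ the conditional plain complexity (minimal length of a program mapping $v$ to $u$). $K(u\mid v)$ denotes conditional prefix-free Kolmogorov complexity (defined via an optimal machine whose domain, for each fixed condition, is prefix-free, i.e. programs are self-delimiting). Pairs and tuples of strings/natural numbers are encoded as strings by a fixed computable injective encoding; natural numbers are identified with binary strings in the standard way. The constant $c$ depends only on the choice of the optimal machines and encodings, not on $a,b$. *)

theory Defs
  imports Main "HOL-Library.Sublist"
begin

section \<open>Partial recursive functions\<close>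

text \<open>
  \<open>reval f xs y\<close> says that the function with code \<open>f\<close> is defined on the tuple \<open>xs\<close> and has
  value \<open>y\<close> there. There is no arity discipline: for each \<open>k\<close>, the codes restricted to tuples of
  length \<open>k\<close> denote exactly the partial recursive functions of arity \<open>k\<close>.
\<close>

datatype recf =
    Zero
  | Succ
  | Proj nat
  | Comp recf "recf list"
  | Prec recf recf
  | Mu recf

inductive reval :: "recf \<Rightarrow> nat list \<Rightarrow> nat \<Rightarrow> bool" where
  reval_Zero: "reval Zero xs 0"
| reval_Succ: "reval Succ [x] (Suc x)"
| reval_Proj: "i < length xs \<Longrightarrow> reval (Proj i) xs (xs ! i)"
| reval_Comp: "list_all2 (\<lambda>g y. reval g xs y) gs ys \<Longrightarrow> reval f ys z \<Longrightarrow> reval (Comp f gs) xs z"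
| reval_Prec_0: "reval f xs y \<Longrightarrow> reval (Prec f g) (0 # xs) y"
| reval_Prec_Suc: "reval (Prec f g) (n # xs) y \<Longrightarrow> reval g (n # y # xs) z \<Longrightarrow>
    reval (Prec f g) (Suc n # xs) z"
| reval_Mu: "reval f (n # xs) 0 \<Longrightarrow> \<forall>m<n. \<exists>k. reval f (m # xs) (Suc k) \<Longrightarrow> reval (Mu f) xs n"

section \<open>Computability on binary strings\<close>

text \<open>
  The standard identification of binary strings with natural numbers, in length-lexicographic
  order: the empty string, 0, 1, 00, 01, 10, and so on correspond to 0, 1, 2, 3, 4, 5, and so on.
  Equivalently, a digit 1 followed by \<open>x\<close> is the binary expansion of \<open>nat_of_string x + 1\<close>.
\<close>

definition nat_of_string :: "bool list \<Rightarrow> nat" where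
  "nat_of_string x = foldl (\<lambda>n d. 2 * n + (if d then 2 else 1)) 0 x"

definition string_of_nat :: "nat \<Rightarrow> bool list" where
  "string_of_nat = inv nat_of_string"

lemma nat_of_string_Nil [simp]: "nat_of_string [] = 0"
  by (simp add: nat_of_string_def)

lemma nat_of_string_snoc [simp]:
  "nat_of_string (x @ [d]) = 2 * nat_of_string x + (if d then 2 else 1)"
  by (simp add: nat_of_string_def)

lemma bij_nat_of_string: "bij nat_of_string"
proof (rule bijI)
  have "nat_of_string x = nat_of_string y \<Longrightarrow> x = y" for x y
  proof (induction x arbitrary: y rule: rev_induct)
    case Nil
    then show ?case by (cases y rule: rev_cases) (auto split: if_splits)
  next
    case (snoc d x)
    from snoc.prems obtain z e where y: "y = z @ [e]"
      by (cases y rule: rev_cases) (auto split: if_splits)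
    have eq: "2 * nat_of_string x + (if d then 2 else 1) =
        2 * nat_of_string z + (if e then 2 else 1)"
      using snoc.prems unfolding y by simp
    have "d = e"
      using arg_cong[OF eq, of even] by (auto split: if_splits)
    with eq show ?case
      using snoc.IH[of z] unfolding y by auto
  qed
  then show "inj nat_of_string" by (rule injI)
  have "n \<in> range nat_of_string" for n
  proof (induction n rule: less_induct)
    case (less n)
    show ?case
    proof (cases "n = 0")
      case True
      then show ?thesis by (metis nat_of_string_Nil rangeI)
    next
      case False
      then obtain x where "nat_of_string x = (n - 1) div 2"
        using less.IH[of "(n - 1) div 2"] by fastforce
      then have "nat_of_string (x @ [even n]) = n"
        using False by (auto elim!: evenE oddE)
      then show ?thesis by (metis rangeI)
    qed
  qed
  then show "surj nat_of_string" by blast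
qed

definition computable :: "(bool list \<Rightarrow> bool list option) \<Rightarrow> bool" where
  "computable D \<longleftrightarrow>
    (\<exists>f. \<forall>p u. D p = Some u \<longleftrightarrow> reval f [nat_of_string p] (nat_of_string u))"

definition computable2 :: "(bool list \<Rightarrow> bool list \<Rightarrow> bool list option) \<Rightarrow> bool" where
  "computable2 M \<longleftrightarrow>
    (\<exists>f. \<forall>p v u. M p v = Some u \<longleftrightarrow>
      reval f [nat_of_string p, nat_of_string v] (nat_of_string u))"

definition pair_encoding :: "(bool list \<Rightarrow> bool list \<Rightarrow> bool list) \<Rightarrow> bool" where
  "pair_encoding e \<longleftrightarrow> computable2 (\<lambda>x y. Some (e x y)) \<and> inj (\<lambda>(x, y). e x y)"

section \<open>Kolmogorov complexity\<close>

text \<open>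
  A machine maps a program, and for conditional complexity also a condition (the second
  argument), to its output. The \<open>LEAST\<close> is over a nonempty set whenever the machine is optimal;
  see the lemmas at the end.
\<close>

definition complexity :: "(bool list \<Rightarrow> bool list option) \<Rightarrow> bool list \<Rightarrow> nat" where
  "complexity D u = (LEAST n. \<exists>p. D p = Some u \<and> length p = n)"

definition cond_complexity ::
  "(bool list \<Rightarrow> bool list \<Rightarrow> bool list option) \<Rightarrow> bool list \<Rightarrow> bool list \<Rightarrow> nat" where
  "cond_complexity M u v = complexity (\<lambda>p. M p v) u"

definition prefix_free :: "bool list set \<Rightarrow> bool" where
  "prefix_free A \<longleftrightarrow> (\<forall>p\<in>A. \<forall>q\<in>A. prefix p q \<longrightarrow> p = q)"

definition prefix_machine :: "(bool list \<Rightarrow> bool list \<Rightarrow> bool list option) \<Rightarrow> bool" where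
  "prefix_machine M \<longleftrightarrow> computable2 M \<and> (\<forall>v. prefix_free (dom (\<lambda>p. M p v)))"

text \<open>
  In the optimality conditions, the inequality between complexities up to an additive constant is
  stated through programs, so that strings without any program on the competing machine (of
  infinite complexity there) impose no requirement.
\<close>

definition optimal_plain :: "(bool list \<Rightarrow> bool list option) \<Rightarrow> bool" where
  "optimal_plain U \<longleftrightarrow> computable U \<and>
    (\<forall>D. computable D \<longrightarrow>
      (\<exists>c. \<forall>p u. D p = Some u \<longrightarrow> (\<exists>q. U q = Some u \<and> length q \<le> length p + c)))"

definition optimal_cond_plain :: "(bool list \<Rightarrow> bool list \<Rightarrow> bool list option) \<Rightarrow> bool" where
  "optimal_cond_plain U \<longleftrightarrow> computable2 U \<and>
    (\<forall>M. computable2 M \<longrightarrow>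
      (\<exists>c. \<forall>p v u. M p v = Some u \<longrightarrow> (\<exists>q. U q v = Some u \<and> length q \<le> length p + c)))"

definition optimal_cond_prefix :: "(bool list \<Rightarrow> bool list \<Rightarrow> bool list option) \<Rightarrow> bool" where
  "optimal_cond_prefix U \<longleftrightarrow> prefix_machine U \<and>
    (\<forall>M. prefix_machine M \<longrightarrow>
      (\<exists>c. \<forall>p v u. M p v = Some u \<longrightarrow> (\<exists>q. U q v = Some u \<and> length q \<le> length p + c)))"

lemma reval_Proj_iff: "reval (Proj i) xs y \<longleftrightarrow> i < length xs \<and> y = xs ! i"
  by (auto elim: reval.cases intro: reval.intros)

lemma nat_of_string_eq_iff: "nat_of_string x = nat_of_string y \<longleftrightarrow> x = y"
  using bij_nat_of_string by (auto simp: bij_def inj_def)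

lemma optimal_plain_has_program:
  assumes "optimal_plain U"
  shows "\<exists>p. U p = Some u"
proof -
  have "computable Some"
    unfolding computable_def
    by (rule exI[of _ "Proj 0"]) (auto simp: reval_Proj_iff nat_of_string_eq_iff)
  then show ?thesis
    using assms unfolding optimal_plain_def by blast
qed

lemma optimal_cond_plain_has_program:
  assumes "optimal_cond_plain U"
  shows "\<exists>p. U p v = Some u"
proof -
  have "computable2 (\<lambda>p v. Some p)"
    unfolding computable2_def
    by (rule exI[of _ "Proj 0"]) (auto simp: reval_Proj_iff nat_of_string_eq_iff)
  then show ?thesis
    using assms unfolding optimal_cond_plain_def by blast
qed

lemma optimal_cond_prefix_has_program:
  assumes "optimal_cond_prefix U"
  shows "\<exists>p. U p v = Some u"
proof -
  define M :: "bool list \<Rightarrow> bool list \<Rightarrow> bool list option"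
    where "M = (\<lambda>p v. if p = [] then Some u else None)"
  define const where "const n = ((\<lambda>f. Comp Succ [f]) ^^ n) Zero" for n
  have const: "reval (const n) xs y \<longleftrightarrow> y = n" for n xs y
  proof (induction n arbitrary: y)
    case 0
    show ?case
      by (auto simp: const_def elim: reval.cases intro: reval.intros)
  next
    case (Suc n)
    have "const (Suc n) = Comp Succ [const n]"
      by (simp add: const_def)
    moreover have "reval (Comp Succ [const n]) xs y \<longleftrightarrow> (\<exists>z. reval (const n) xs z \<and> y = Suc z)"
    proof
      assume "reval (Comp Succ [const n]) xs y"
      then show "\<exists>z. reval (const n) xs z \<and> y = Suc z"
        by (cases rule: reval.cases) (auto simp: list_all2_Cons1 elim: reval.cases)
    next
      assume "\<exists>z. reval (const n) xs z \<and> y = Suc z"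
      then obtain z where z: "reval (const n) xs z" "y = Suc z" by blast
      have "list_all2 (\<lambda>g y. reval g xs y) [const n] [z]"
        using z by simp
      then show "reval (Comp Succ [const n]) xs y"
        using z reval_Succ by (blast intro: reval_Comp)
    qed
    ultimately show ?case
      using Suc.IH by simp
  qed
  have mu: "reval (Mu (Proj (Suc 0))) (x # xs) y \<longleftrightarrow> x = 0 \<and> y = 0" for x xs y
  proof
    assume "reval (Mu (Proj (Suc 0))) (x # xs) y"
    then show "x = 0 \<and> y = 0"
      by (cases rule: reval.cases) (force simp: reval_Proj_iff)
  next
    assume "x = 0 \<and> y = 0"
    then show "reval (Mu (Proj (Suc 0))) (x # xs) y"
      by (auto intro!: reval_Mu simp: reval_Proj_iff)
  qed
  let ?f = "Comp (const (nat_of_string u)) [Mu (Proj (Suc 0))]"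
  have "reval ?f (x # xs) y \<longleftrightarrow> x = 0 \<and> y = nat_of_string u" for x xs y
  proof
    assume "reval ?f (x # xs) y"
    then show "x = 0 \<and> y = nat_of_string u"
      by (cases rule: reval.cases) (auto simp: list_all2_Cons1 const mu)
  next
    assume "x = 0 \<and> y = nat_of_string u"
    then show "reval ?f (x # xs) y"
      by (auto intro!: reval_Comp[where ys = "[0]"] simp: const mu)
  qed
  moreover have "nat_of_string p = 0 \<longleftrightarrow> p = []" for p
    using nat_of_string_eq_iff[of p "[]"] by simp
  ultimately have "computable2 M"
    unfolding computable2_def M_def
    by (intro exI[of _ ?f]) (auto simp: nat_of_string_eq_iff)
  then have "prefix_machine M"
    by (auto simp: prefix_machine_def prefix_free_def M_def split: if_splits)
  then obtain c where "\<forall>p v u. M p v = Some u \<longrightarrow> (\<exists>q. U q v = Some u \<and> length q \<le> length p + c)"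
    using assms unfolding optimal_cond_prefix_def by blast
  moreover have "M [] v = Some u"
    by (simp add: M_def)
  ultimately show ?thesis by blast
qed

end

theory Submission
  imports Defs "HOL-Library.Nat_Bijection"
begin

text \<open>
  Put \<open>n = C(a,b)\<close>.

  For \<open>C(a,b) \<le> K(a | n) + C(b | a,n) + O(1)\<close>, concatenate a self-delimiting program of \<open>a\<close> with a
  program of \<open>b\<close> to a string \<open>s\<close>. Both need \<open>n\<close>, which is recovered from the length of \<open>s\<close> and
  the excess of \<open>n\<close> over it. Writing down half the excess in unary yields a description that is
  shorter than \<open>n\<close> by half the excess, up to a constant, so minimality of \<open>n\<close> bounds the excess.

  For the converse, enumerate the fewer than \<open>2 ^ (n + 1)\<close> pairs of complexity at most \<open>n\<close>. If
  between \<open>2 ^ l\<close> and \<open>2 ^ (l + 1)\<close> of them have first component \<open>a\<close>, then \<open>b\<close> is given by its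
  index among these, at cost \<open>l\<close>. Whenever the number of pairs enumerated for some \<open>a\<close> reaches
  a power \<open>2 ^ j\<close>, the next \<open>2 * 2 ^ j\<close> units of an interval of length \<open>2 ^ (n + 3)\<close> are reserved for \<open>a\<close>;
  they contain an aligned block of size \<open>2 ^ j\<close>, that is, a codeword of length \<open>n + 3 - j\<close>.
  The blocks are disjoint, so the codewords are prefix-free and \<open>K(a | n) \<le> n - l + O(1)\<close>.
\<close>

section \<open>Recursive functions, decidable and semidecidable predicates\<close>

text \<open>
  The arguments form an environment \<open>e\<close>. Requiring a code for all large arities says that \<open>F\<close>
  depends on finitely many arguments only, and spares keeping track of arities. New variables are
  bound de Bruijn style, at index 0.
\<close>

definition recursive :: "((nat \<Rightarrow> nat) \<Rightarrow> nat) \<Rightarrow> bool" where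
  "recursive F \<longleftrightarrow> (\<exists>k0. \<forall>k\<ge>k0. \<exists>f. \<forall>e y. reval f (map e [0..<k]) y \<longleftrightarrow> y = F e)"

definition decidable :: "((nat \<Rightarrow> nat) \<Rightarrow> bool) \<Rightarrow> bool" where
  "decidable P \<longleftrightarrow> recursive (\<lambda>e. if P e then 1 else 0)"

definition semidecidable :: "((nat \<Rightarrow> nat) \<Rightarrow> bool) \<Rightarrow> bool" where
  "semidecidable P \<longleftrightarrow>
    (\<exists>Q. decidable (\<lambda>e. Q (e 0) (\<lambda>i. e (Suc i))) \<and> (\<forall>e. P e \<longleftrightarrow> (\<exists>w. Q w e)))"

section \<open>Evaluation rules as equivalences\<close>

lemma map_upt_Suc_shift: "map e [0..<Suc k] = e 0 # map (\<lambda>i. e (Suc i)) [0..<k]"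
  by (simp only: map_upt_Suc)

lemma reval_Zero_iff: "reval Zero xs y \<longleftrightarrow> y = 0"
  by (auto elim: reval.cases intro: reval.intros)

lemma reval_Succ_iff: "reval Succ xs y \<longleftrightarrow> (\<exists>x. xs = [x] \<and> y = Suc x)"
  by (auto elim: reval.cases intro: reval.intros)

lemma reval_Comp_iff:
  "reval (Comp f gs) xs z \<longleftrightarrow> (\<exists>ys. list_all2 (\<lambda>g y. reval g xs y) gs ys \<and> reval f ys z)"
  by (auto elim: reval.cases intro: reval.intros)

lemma reval_Prec_Nil: "\<not> reval (Prec f g) [] y"
  by (auto elim: reval.cases)

lemma reval_Prec_0_iff: "reval (Prec f g) (0 # xs) y \<longleftrightarrow> reval f xs y"
  by (auto elim: reval.cases intro: reval.intros)

lemma reval_Prec_Suc_iff: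
  "reval (Prec f g) (Suc n # xs) z \<longleftrightarrow> (\<exists>y. reval (Prec f g) (n # xs) y \<and> reval g (n # y # xs) z)"
  by (auto elim: reval.cases intro: reval.intros)

lemma reval_Mu_iff:
  "reval (Mu f) xs n \<longleftrightarrow> reval f (n # xs) 0 \<and> (\<forall>m<n. \<exists>k. reval f (m # xs) (Suc k))"
  by (auto elim: reval.cases intro: reval.intros)

text \<open>When every inner code is total with a known value, only one tuple of intermediate
  results is possible, so composition becomes substitution.\<close>

lemma reval_Comp_map:
  assumes "\<And>i y. i < k \<Longrightarrow> reval (g i) xs y \<longleftrightarrow> y = h i"
  shows "reval (Comp f (map g [0..<k])) xs z \<longleftrightarrow> reval f (map h [0..<k]) z"
proof -
  have "list_all2 (\<lambda>g y. reval g xs y) (map g [0..<k]) ys \<longleftrightarrow> ys = map h [0..<k]" for ys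
    using assms by (auto simp: list_all2_conv_all_nth intro!: nth_equalityI)
  then show ?thesis by (simp add: reval_Comp_iff)
qed

section \<open>Closure properties of total recursive functions\<close>

lemma recursive_cong: "(\<And>e. F e = G e) \<Longrightarrow> recursive F \<Longrightarrow> recursive G"
  by presburger

lemma recursive_proj: "recursive (\<lambda>e. e i)"
  unfolding recursive_def
proof (intro exI[of _ "Suc i"] allI impI)
  fix k assume "Suc i \<le> k"
  then show "\<exists>f. \<forall>e y. reval f (map e [0..<k]) y \<longleftrightarrow> y = e i"
    by (intro exI[of _ "Proj i"]) (auto simp: reval_Proj_iff)
qed

lemma recursive_zero: "recursive (\<lambda>e. 0)"
  unfolding recursive_def by (metis reval_Zero_iff)

text \<open>Although \<open>A\<close> is an infinite family, a code for \<open>F\<close> at one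
  arity \<open>m\<close> reads only the first \<open>m\<close> values. The sum of their arity bounds
  then serves for the composite. Taking the \<open>A i\<close> to be projections gives all renamings
  of variables.\<close>

lemma recursive_subst:
  assumes "recursive F" and "\<And>i. recursive (A i)"
  shows "recursive (\<lambda>e. F (\<lambda>i. A i e))"
proof -
  obtain m f where f: "\<And>e y. reval f (map e [0..<m]) y \<longleftrightarrow> y = F e"
    using assms(1) unfolding recursive_def by blast
  obtain k0 where k0: "\<And>i k. k \<ge> k0 i \<Longrightarrow> \<exists>g. \<forall>e y. reval g (map e [0..<k]) y \<longleftrightarrow> y = A i e"
    using assms(2) unfolding recursive_def by metis
  show ?thesis unfolding recursive_def
  proof (intro exI[of _ "\<Sum>i<m. k0 i"] allI impI)
    fix k assume k: "(\<Sum>i<m. k0 i) \<le> k"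
    have "\<exists>g. \<forall>e y. reval g (map e [0..<k]) y \<longleftrightarrow> y = A i e" if "i < m" for i
      using that k member_le_sum[of i "{..<m}" k0] by (intro k0) auto
    then obtain g where g: "\<And>i e y. i < m \<Longrightarrow> reval (g i) (map e [0..<k]) y \<longleftrightarrow> y = A i e"
      by metis
    show "\<exists>f. \<forall>e y. reval f (map e [0..<k]) y \<longleftrightarrow> y = F (\<lambda>i. A i e)"
      by (rule exI[of _ "Comp f (map g [0..<m])"])
        (use g f in \<open>simp add: reval_Comp_map[where h = "\<lambda>i. A i _"]\<close>)
  qed
qed

lemma recursive_Suc:
  assumes "recursive F"
  shows "recursive (\<lambda>e. Suc (F e))"
proof -
  obtain k0 where k0: "\<And>k. k \<ge> k0 \<Longrightarrow> \<exists>f. \<forall>e y. reval f (map e [0..<k]) y \<longleftrightarrow> y = F e"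
    using assms unfolding recursive_def by metis
  have "\<exists>g. \<forall>e y. reval g (map e [0..<k]) y \<longleftrightarrow> y = Suc (F e)" if k: "k \<ge> k0" for k
  proof -
    obtain f where "\<And>e y. reval f (map e [0..<k]) y \<longleftrightarrow> y = F e" using k0[OF k] by blast
    then show ?thesis
      by (intro exI[of _ "Comp Succ [f]"]) (auto simp: reval_Comp_iff reval_Succ_iff list_all2_Cons1)
  qed
  then show ?thesis unfolding recursive_def by blast
qed

lemma recursive_const: "recursive (\<lambda>e. c)"
  by (induction c) (auto intro: recursive_zero recursive_Suc)

text \<open>\<open>Prec\<close> recurses on its first argument. The recursion is therefore treated
  first with the counter at index 0 and the parameters shifted by one; an arbitrary \<open>N\<close>
  is substituted at the end.\<close>

lemma recursive_rec_nat:
  assumes "recursive F" and "recursive (\<lambda>e. G (e 0) (e (Suc 0)) (\<lambda>i. e (Suc (Suc i))))"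
    and "recursive N"
  shows "recursive (\<lambda>e. rec_nat (F e) (\<lambda>i r. G i r e) (N e))"
proof -
  let ?H = "\<lambda>e. rec_nat (F (\<lambda>i. e (Suc i))) (\<lambda>i r. G i r (\<lambda>i. e (Suc i))) (e 0)"
  obtain k1 where k1: "\<And>k. k \<ge> k1 \<Longrightarrow> \<exists>f. \<forall>e y. reval f (map e [0..<k]) y \<longleftrightarrow> y = F e"
    using assms(1) unfolding recursive_def by metis
  obtain k2 where k2: "\<And>k. k \<ge> k2 \<Longrightarrow> \<exists>f. \<forall>e y. reval f (map e [0..<k]) y \<longleftrightarrow>
      y = G (e 0) (e (Suc 0)) (\<lambda>i. e (Suc (Suc i)))"
    using assms(2) unfolding recursive_def by metis
  have "recursive ?H" unfolding recursive_def
  proof (intro exI[of _ "Suc (k1 + k2)"] allI impI)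
    fix k assume "Suc (k1 + k2) \<le> k"
    then obtain m where k: "k = Suc m" and m: "k1 \<le> m" "k2 \<le> m" by (cases k) auto
    obtain f where f: "\<And>e y. reval f (map e [0..<m]) y \<longleftrightarrow> y = F e"
      using k1[OF m(1)] by blast
    obtain g where g: "\<And>e y. reval g (map e [0..<Suc (Suc m)]) y \<longleftrightarrow>
        y = G (e 0) (e (Suc 0)) (\<lambda>i. e (Suc (Suc i)))"
      using k2[of "Suc (Suc m)"] m by auto
    have g': "reval g (i # r # map e [0..<m]) y \<longleftrightarrow> y = G i r e" for i r e y
      using g[of "case_nat i (case_nat r e)" y] unfolding map_upt_Suc_shift by simp
    have "reval (Prec f g) (n # map e [0..<m]) y \<longleftrightarrow> y = rec_nat (F e) (\<lambda>i r. G i r e) n" for n e y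
      by (induction n arbitrary: y) (auto simp: reval_Prec_0_iff reval_Prec_Suc_iff f g')
    then show "\<exists>f. \<forall>e y. reval f (map e [0..<k]) y \<longleftrightarrow> y = ?H e"
      unfolding k map_upt_Suc_shift by blast
  qed
  then have "recursive (\<lambda>e. ?H (\<lambda>i. (case i of 0 \<Rightarrow> N | Suc j \<Rightarrow> (\<lambda>e. e j)) e))"
    by (rule recursive_subst) (auto split: nat.split intro: assms recursive_proj)
  then show ?thesis by simp
qed

lemma recursive_subst1: "recursive (\<lambda>e. h (e 0)) \<Longrightarrow> recursive A \<Longrightarrow> recursive (\<lambda>e. h (A e))"
  using recursive_subst[of "\<lambda>e. h (e 0)" "\<lambda>i. A"] by simp

lemma recursive_subst2:
  assumes "recursive (\<lambda>e. h (e 0) (e 1))" "recursive A" "recursive B"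
  shows "recursive (\<lambda>e. h (A e) (B e))"
  using recursive_subst[OF assms(1), of "\<lambda>i. if i = 0 then A else B"] assms(2-) by simp

lemma recursive_subst3:
  assumes "recursive (\<lambda>e. h (e 0) (e 1) (e 2))" "recursive A" "recursive B" "recursive C"
  shows "recursive (\<lambda>e. h (A e) (B e) (C e))"
  using recursive_subst[OF assms(1), of "\<lambda>i. if i = 0 then A else if i = 1 then B else C"] assms(2-)
  by simp

lemma recursive_add: "recursive F \<Longrightarrow> recursive G \<Longrightarrow> recursive (\<lambda>e. F e + G e)"
proof -
  assume *: "recursive F" "recursive G"
  have "rec_nat a (\<lambda>i. Suc) b = a + b" for a b by (induction b) auto
  then show ?thesis
    using recursive_rec_nat[of F "\<lambda>i r e. Suc r" G] * by (simp add: recursive_Suc recursive_proj)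
qed

lemma recursive_mult: "recursive F \<Longrightarrow> recursive G \<Longrightarrow> recursive (\<lambda>e. F e * G e)"
proof -
  assume *: "recursive F" "recursive G"
  have eq: "rec_nat 0 (\<lambda>i r. r + a) b = a * b" for a b :: nat by (induction b) auto
  have "recursive (\<lambda>e. rec_nat 0 (\<lambda>i r. r + F e) (G e))"
    by (intro recursive_rec_nat recursive_add recursive_proj recursive_const *
        recursive_subst[OF *(1)])
  then show ?thesis unfolding eq .
qed

lemma recursive_power: "recursive F \<Longrightarrow> recursive G \<Longrightarrow> recursive (\<lambda>e. F e ^ G e)"
proof -
  assume *: "recursive F" "recursive G"
  have eq: "rec_nat 1 (\<lambda>i r. r * a) b = a ^ b" for a b :: nat by (induction b) auto
  have "recursive (\<lambda>e. rec_nat 1 (\<lambda>i r. r * F e) (G e))"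
    by (intro recursive_rec_nat recursive_mult recursive_proj recursive_const *
        recursive_subst[OF *(1)])
  then show ?thesis unfolding eq .
qed

lemma recursive_pred: "recursive F \<Longrightarrow> recursive (\<lambda>e. F e - 1)"
proof -
  assume *: "recursive F"
  have eq: "rec_nat 0 (\<lambda>i r. i) b = b - 1" for b :: nat by (induction b) auto
  have "recursive (\<lambda>e. rec_nat 0 (\<lambda>i r. i) (F e))"
    by (intro recursive_rec_nat recursive_proj recursive_const *)
  then show ?thesis unfolding eq .
qed

lemma recursive_diff: "recursive F \<Longrightarrow> recursive G \<Longrightarrow> recursive (\<lambda>e. F e - G e)"
proof -
  assume *: "recursive F" "recursive G"
  have eq: "rec_nat a (\<lambda>i r. r - 1) b = a - b" for a b :: nat by (induction b) auto
  have "recursive (\<lambda>e. rec_nat (F e) (\<lambda>i r. r - 1) (G e))"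
    by (intro recursive_rec_nat recursive_pred recursive_proj recursive_const *)
  then show ?thesis unfolding eq .
qed

lemma recursive_sum:
  assumes "recursive (\<lambda>e. F (e 0) (\<lambda>i. e (Suc i)))" and "recursive N"
  shows "recursive (\<lambda>e. \<Sum>i<N e. F i e)"
proof -
  have eq: "rec_nat 0 (\<lambda>i r. r + f i) b = (\<Sum>i<b. f i)" for f and b :: nat
    by (induction b) auto
  \<comment> \<open>Inside the recursion, index 0 is the counter and index 1 the accumulator. The
    summand must skip the latter.\<close>
  have *: "recursive (\<lambda>e. F (e 0) (\<lambda>i. e (Suc (Suc i))))"
    using recursive_subst[OF assms(1), of "\<lambda>i e. e (if i = 0 then 0 else Suc i)"]
    by (simp add: recursive_proj)
  have "recursive (\<lambda>e. rec_nat 0 (\<lambda>i r. r + F i e) (N e))"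
    by (intro recursive_rec_nat recursive_add recursive_proj recursive_const * assms)
  then show ?thesis unfolding eq .
qed

lemma recursive_if:
  assumes "decidable P" "recursive F" "recursive G"
  shows "recursive (\<lambda>e. if P e then F e else G e)"
proof -
  have "recursive (\<lambda>e. (if P e then 1 else 0) * F e + (1 - (if P e then 1 else 0)) * G e)"
    using assms unfolding decidable_def
    by (intro recursive_add recursive_mult recursive_diff recursive_const)
  moreover have "(if P e then 1 else 0) * F e + (1 - (if P e then 1 else 0)) * G e =
      (if P e then F e else G e)" for e by simp
  ultimately show ?thesis by (rule recursive_cong[rotated])
qed

section \<open>Decidable predicates, bounded quantifiers and minimization\<close>

lemma decidable_const: "decidable (\<lambda>e. b)"
  by (simp add: decidable_def recursive_const)

lemma decidable_if:
  assumes "decidable P" "decidable Q" "decidable R"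
  shows "decidable (\<lambda>e. if P e then Q e else R e)"
proof -
  have "recursive (\<lambda>e. if P e then (if Q e then 1 else 0) else (if R e then 1 else 0))"
    using assms by (intro recursive_if recursive_const)
  then show ?thesis
    unfolding decidable_def by (rule recursive_cong[rotated]) simp
qed

lemma decidable_not:
  assumes "decidable P"
  shows "decidable (\<lambda>e. \<not> P e)"
proof -
  have "(\<lambda>e. if P e then False else True) = (\<lambda>e. \<not> P e)" by auto
  then show ?thesis using decidable_if[OF assms decidable_const decidable_const, of False True] by simp
qed

lemma decidable_conj:
  assumes "decidable P" "decidable Q"
  shows "decidable (\<lambda>e. P e \<and> Q e)"
proof -
  have "(\<lambda>e. if P e then Q e else False) = (\<lambda>e. P e \<and> Q e)" by auto
  then show ?thesis using decidable_if[OF assms decidable_const, of False] by simp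
qed

lemma decidable_le:
  assumes "recursive F" "recursive G"
  shows "decidable (\<lambda>e. F e \<le> G e)"
proof -
  have "recursive (\<lambda>e. 1 - (F e - G e))"
    by (intro recursive_diff recursive_const assms)
  then show ?thesis unfolding decidable_def by (rule recursive_cong[rotated]) simp
qed

lemma decidable_less: "recursive F \<Longrightarrow> recursive G \<Longrightarrow> decidable (\<lambda>e. F e < G e)"
  using decidable_le[of "\<lambda>e. Suc (F e)" G] by (simp add: Suc_le_eq recursive_Suc)

lemma decidable_eq: "recursive F \<Longrightarrow> recursive G \<Longrightarrow> decidable (\<lambda>e. F e = G e)"
  unfolding order_eq_iff by (intro decidable_conj decidable_le)

lemma decidable_bex:
  assumes "decidable (\<lambda>e. P (e 0) (\<lambda>i. e (Suc i)))" and "recursive N"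
  shows "decidable (\<lambda>e. \<exists>i<N e. P i e)"
proof -
  have "decidable (\<lambda>e. (\<Sum>i<N e. if P i e then 1 else 0 :: nat) > 0)"
    using assms unfolding decidable_def[of "\<lambda>e. P (e 0) (\<lambda>i. e (Suc i))"]
    by (intro decidable_less recursive_const recursive_sum)
  moreover have "(\<Sum>i<N e. if P i e then 1 else 0 :: nat) > 0 \<longleftrightarrow> (\<exists>i<N e. P i e)" for e
    by (subst zero_less_iff_neq_zero) (auto simp: lessThan_def)
  ultimately show ?thesis by simp
qed

lemma decidable_ball:
  assumes "decidable (\<lambda>e. P (e 0) (\<lambda>i. e (Suc i)))" and "recursive N"
  shows "decidable (\<lambda>e. \<forall>i<N e. P i e)"
  using decidable_not[OF decidable_bex[of "\<lambda>i e. \<not> P i e" N]] assms by (simp add: decidable_not)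

lemma decidable_subst:
  assumes "decidable P" and "\<And>i. recursive (A i)"
  shows "decidable (\<lambda>e. P (\<lambda>i. A i e))"
  using recursive_subst[of "\<lambda>e. if P e then 1 else 0" A] assms by (simp add: decidable_def)

text \<open>\<open>Mu\<close> searches for a zero, so the test is coded with 0 for true. The
  hypothesis \<open>ex\<close> makes the search total.\<close>

lemma recursive_Least:
  assumes "decidable (\<lambda>e. P (e 0) (\<lambda>i. e (Suc i)))" and ex: "\<And>e. \<exists>w. P w e"
  shows "recursive (\<lambda>e. LEAST w. P w e)"
proof -
  have "recursive (\<lambda>e. if P (e 0) (\<lambda>i. e (Suc i)) then 0 else 1)"
    using assms(1) by (intro recursive_if recursive_const)
  then obtain k0 where k0: "\<And>k. k \<ge> k0 \<Longrightarrow> \<exists>f. \<forall>e y. reval f (map e [0..<k]) y \<longleftrightarrow>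
      y = (if P (e 0) (\<lambda>i. e (Suc i)) then 0 else 1)"
    unfolding recursive_def by metis
  show ?thesis unfolding recursive_def
  proof (intro exI[of _ k0] allI impI)
    fix k assume "k0 \<le> k"
    then obtain f where f: "\<And>e y. reval f (map e [0..<Suc k]) y \<longleftrightarrow>
      y = (if P (e 0) (\<lambda>i. e (Suc i)) then 0 else 1)" using k0[of "Suc k"] by auto
    have f': "reval f (n # map e [0..<k]) y \<longleftrightarrow> y = (if P n e then 0 else 1)" for n e y
      using f[of "case_nat n e" y] unfolding map_upt_Suc_shift by simp
    have "reval (Mu f) (map e [0..<k]) y \<longleftrightarrow> y = (LEAST w. P w e)" for e y
    proof -
      have "reval (Mu f) (map e [0..<k]) y \<longleftrightarrow> P y e \<and> (\<forall>m<y. \<not> P m e)"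
        unfolding reval_Mu_iff f' by auto
      also have "\<dots> \<longleftrightarrow> y = (LEAST w. P w e)"
        using ex[of e] by (metis LeastI not_less_Least linorder_neqE_nat)
      finally show ?thesis .
    qed
    then show "\<exists>f. \<forall>e y. reval f (map e [0..<k]) y \<longleftrightarrow> y = (LEAST w. P w e)" by blast
  qed
qed

section \<open>Closure properties of semidecidable predicates\<close>

lemma semidecidable_decidable: "decidable P \<Longrightarrow> semidecidable P"
  unfolding semidecidable_def
  using decidable_subst[of P "\<lambda>i e. e (Suc i)"]
  by (intro exI[of _ "\<lambda>w. P"]) (simp add: recursive_proj)

text \<open>Two unbounded searches, for \<open>x\<close> and for the witness \<open>w\<close>, merge
  into one search for a common bound \<open>W\<close> on both, below which everything is
  decidable.\<close>

lemma semidecidable_ex: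
  assumes "semidecidable (\<lambda>e. P (e 0) (\<lambda>i. e (Suc i)))"
  shows "semidecidable (\<lambda>e. \<exists>x. P x e)"
proof -
  obtain Q where Q: "decidable (\<lambda>e. Q (e 0) (\<lambda>i. e (Suc i)))"
    and P: "\<And>e. P (e 0) (\<lambda>i. e (Suc i)) \<longleftrightarrow> (\<exists>w. Q w e)"
    using assms unfolding semidecidable_def by auto
  have P': "P x e \<longleftrightarrow> (\<exists>w. Q w (case_nat x e))" for x e
    using P[of "case_nat x e"] by simp
  \<comment> \<open>Under the two bounded quantifiers index 0 is \<open>x\<close>, index 1 is
    \<open>w\<close>, and index 2 is the bound, which is skipped; the parameters start at index
    3.\<close>
  have Q': "decidable (\<lambda>e. Q (e 1) (case_nat (e 0) (\<lambda>i. e (Suc (Suc (Suc i))))))"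
  proof -
    have "decidable (\<lambda>e. Q (e 1) (\<lambda>i. e (if i = 0 then 0 else Suc (Suc i))))"
      using decidable_subst[OF Q, of "\<lambda>i e. e (if i = 0 then 1 else if i = 1 then 0 else Suc i)"]
      by (simp add: recursive_proj)
    moreover have "(\<lambda>i. e (if i = 0 then 0 else Suc (Suc i))) =
        case_nat (e 0) (\<lambda>i. e (Suc (Suc (Suc i))))" for e :: "nat \<Rightarrow> nat"
      by (auto split: nat.split)
    ultimately show ?thesis by simp
  qed
  have "decidable (\<lambda>e. \<exists>w<e 0. \<exists>x<e 0. Q w (case_nat x (\<lambda>i. e (Suc i))))"
    using Q' by (intro decidable_bex recursive_proj) simp
  moreover have "(\<exists>x. P x e) \<longleftrightarrow> (\<exists>W. \<exists>w<W. \<exists>x<W. Q w (case_nat x e))" for e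
  proof
    assume "\<exists>x. P x e"
    then obtain x w where "Q w (case_nat x e)" using P' by blast
    then show "\<exists>W. \<exists>w<W. \<exists>x<W. Q w (case_nat x e)"
      by (intro exI[of _ "Suc (w + x)"] exI[of _ w] conjI exI[of _ x]) auto
  qed (use P' in blast)
  ultimately show ?thesis
    unfolding semidecidable_def
    by (intro exI[of _ "\<lambda>W e. \<exists>w<W. \<exists>x<W. Q w (case_nat x e)"]) simp
qed

lemma semidecidable_subst:
  assumes "semidecidable P" and "\<And>i. recursive (A i)"
  shows "semidecidable (\<lambda>e. P (\<lambda>i. A i e))"
proof -
  obtain Q where Q: "decidable (\<lambda>e. Q (e 0) (\<lambda>i. e (Suc i)))" and P: "\<And>e. P e \<longleftrightarrow> (\<exists>w. Q w e)"
    using assms(1) unfolding semidecidable_def by auto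
  have "decidable (\<lambda>e. Q (e 0) (\<lambda>i. A i (\<lambda>i. e (Suc i))))"
    using decidable_subst[OF Q, of "\<lambda>i. case i of 0 \<Rightarrow> (\<lambda>e. e 0) | Suc j \<Rightarrow> (\<lambda>e. A j (\<lambda>i. e (Suc i)))"]
      recursive_subst[OF assms(2), of "\<lambda>i e. e (Suc i)"]
    by (simp add: recursive_proj split: nat.split)
  then show ?thesis unfolding semidecidable_def
    by (intro exI[of _ "\<lambda>w e. Q w (\<lambda>i. A i e)"]) (simp add: P)
qed

lemma semidecidable_conj:
  assumes "semidecidable P" "semidecidable Q"
  shows "semidecidable (\<lambda>e. P e \<and> Q e)"
proof -
  obtain P' where P': "decidable (\<lambda>e. P' (e 0) (\<lambda>i. e (Suc i)))" and P: "\<And>e. P e \<longleftrightarrow> (\<exists>w. P' w e)"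
    using assms(1) unfolding semidecidable_def by auto
  obtain Q' where Q': "decidable (\<lambda>e. Q' (e 0) (\<lambda>i. e (Suc i)))" and Q: "\<And>e. Q e \<longleftrightarrow> (\<exists>w. Q' w e)"
    using assms(2) unfolding semidecidable_def by auto
  have shiftP: "decidable (\<lambda>e. P' (e 1) (\<lambda>i. e (Suc (Suc i))))"
    using decidable_subst[OF P', of "\<lambda>i e. e (Suc i)"] by (simp add: recursive_proj)
  have shiftQ: "decidable (\<lambda>e. Q' (e 0) (\<lambda>i. e (Suc (Suc i))))"
    using decidable_subst[OF Q', of "\<lambda>i e. e (if i = 0 then 0 else Suc i)"]
    by (simp add: recursive_proj)
  have "semidecidable (\<lambda>e. \<exists>x y. P' x e \<and> Q' y e)"
    using shiftP shiftQ
    by (intro semidecidable_ex semidecidable_decidable decidable_conj) simp_all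
  then show ?thesis by (simp add: P Q)
qed

lemma semidecidable_subst2:
  assumes "semidecidable (\<lambda>e. h (e 0) (e 1))" "recursive A" "recursive B"
  shows "semidecidable (\<lambda>e. h (A e) (B e))"
  using semidecidable_subst[OF assms(1), of "\<lambda>i. if i = 0 then A else B"] assms(2-) by simp

lemma semidecidable_subst3:
  assumes "semidecidable (\<lambda>e. h (e 0) (e 1) (e 2))" "recursive A" "recursive B" "recursive C"
  shows "semidecidable (\<lambda>e. h (A e) (B e) (C e))"
  using semidecidable_subst[OF assms(1), of "\<lambda>i. if i = 0 then A else if i = 1 then B else C"]
    assms(2-) by simp

section \<open>Normal form of partial recursive functions\<close>

text \<open>
  \<open>T s e\<close> simulates the fixed code \<open>f\<close> for \<open>s\<close> steps: 0 means no result yet, \<open>Suc y\<close> means result \<open>y\<close>.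
  Such functions exist by induction on \<open>f\<close>, so no universal function is needed.
\<close>

definition step_function :: "recf \<Rightarrow> nat \<Rightarrow> (nat \<Rightarrow> (nat \<Rightarrow> nat) \<Rightarrow> nat) \<Rightarrow> bool" where
  "step_function f k T \<longleftrightarrow>
    recursive (\<lambda>e. T (e 0) (\<lambda>i. e (Suc i))) \<and>
    (\<forall>s s' e y. s \<le> s' \<longrightarrow> T s e = Suc y \<longrightarrow> T s' e = Suc y) \<and>
    (\<forall>e y. reval f (map e [0..<k]) y \<longleftrightarrow> (\<exists>s. T s e = Suc y))"

lemma step_functionD:
  assumes "step_function f k T"
  shows "recursive (\<lambda>e. T (e 0) (\<lambda>i. e (Suc i)))"
    and "s \<le> s' \<Longrightarrow> T s e = Suc y \<Longrightarrow> T s' e = Suc y"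
    and "reval f (map e [0..<k]) y \<longleftrightarrow> (\<exists>s. T s e = Suc y)"
  using assms unfolding step_function_def by blast+

lemma recursive_env_subst:
  assumes "recursive (\<lambda>e. T (e 0) (\<lambda>i. e (Suc i)))" "recursive S" "\<And>i. recursive (A i)"
  shows "recursive (\<lambda>e. T (S e) (\<lambda>i. A i e))"
  using recursive_subst[OF assms(1), of "case_nat S A"] assms(2-)
  by (simp split: nat.split)

lemma decidable_env_subst:
  assumes "decidable (\<lambda>e. Q (e 0) (\<lambda>i. e (Suc i)))" "recursive S" "\<And>i. recursive (A i)"
  shows "decidable (\<lambda>e. Q (S e) (\<lambda>i. A i e))"
  using decidable_subst[OF assms(1), of "case_nat S A"] assms(2-)
  by (simp split: nat.split)

lemma recursive_case_nat:
  "recursive A \<Longrightarrow> (\<And>i. recursive (B i)) \<Longrightarrow> recursive (\<lambda>e. case n of 0 \<Rightarrow> A e | Suc i \<Rightarrow> B i e)"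
  by (cases n) auto

lemma decidable_all_less:
  fixes m :: nat
  shows "(\<And>i. i < m \<Longrightarrow> decidable (P i)) \<Longrightarrow> decidable (\<lambda>e. \<forall>i<m. P i e)"
  by (induction m) (auto simp: All_less_Suc decidable_const intro: decidable_conj)

text \<open>All inner codes are simulated with the same budget \<open>s\<close>; only when each has
  a result is \<open>f\<close> simulated on these results, again with budget \<open>s\<close>.
  Monotonicity in the budget reconciles the different times at which the parts halt.\<close>

lemma step_function_Comp:
  assumes f: "step_function f (length gs) T" and g: "\<And>i. i < length gs \<Longrightarrow> step_function (gs ! i) k (G i)"
  shows "\<exists>T. step_function (Comp f gs) k T"
proof -
  let ?m = "length gs"
  \<comment> \<open>Subtracting 1 strips the \<open>Suc\<close> that marks a result. The default 0
    beyond \<open>?m\<close> makes the whole environment of \<open>f\<close> determined by the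
    results.\<close>
  define A where "A i s e = (if i < ?m then G i s e - 1 else 0)" for i s and e :: "nat \<Rightarrow> nat"
  define H where "H s e = (if \<forall>i<?m. 0 < G i s e then T s (\<lambda>i. A i s e) else 0)" for s e
  have "recursive (\<lambda>e. A i (e 0) (\<lambda>i. e (Suc i)))" for i
    unfolding A_def using step_functionD(1)[OF g, of i]
    by (cases "i < ?m") (auto intro!: recursive_diff recursive_const)
  then have "recursive (\<lambda>e. H (e 0) (\<lambda>i. e (Suc i)))"
    unfolding H_def using step_functionD(1)[OF g]
    by (intro recursive_if decidable_all_less decidable_less recursive_const
        recursive_env_subst[OF step_functionD(1)[OF f]] recursive_proj)
  moreover have mono: "H s' e = Suc y" if "s \<le> s'" "H s e = Suc y" for s s' e y
  proof -
    from that(2) have pos: "\<forall>i<?m. 0 < G i s e" and T: "T s (\<lambda>i. A i s e) = Suc y"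
      by (auto simp: H_def split: if_splits)
    have "G i s' e = G i s e" if "i < ?m" for i
      using step_functionD(2)[OF g[OF that], OF \<open>s \<le> s'\<close>, of e "G i s e - 1"] pos that by simp
    then have "(\<lambda>i. A i s' e) = (\<lambda>i. A i s e)" and "\<forall>i<?m. 0 < G i s' e"
      using pos by (auto simp: A_def fun_eq_iff)
    then show ?thesis
      using step_functionD(2)[OF f, OF \<open>s \<le> s'\<close> T] by (simp add: H_def)
  qed
  moreover have "reval (Comp f gs) (map e [0..<k]) y \<longleftrightarrow> (\<exists>s. H s e = Suc y)" for e y
  proof
    assume "reval (Comp f gs) (map e [0..<k]) y"
    then obtain ys where ys: "list_all2 (\<lambda>g y. reval g (map e [0..<k]) y) gs ys" and fy: "reval f ys y"
      by (auto simp: reval_Comp_iff)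
    then have len: "length ys = ?m" by (simp add: list_all2_lengthD)
    have "\<exists>s. G i s e = Suc (ys ! i)" if "i < ?m" for i
      using step_functionD(3)[OF g[OF that], of e "ys ! i"] ys that by (auto simp: list_all2_conv_all_nth)
    then obtain s where s: "\<And>i. i < ?m \<Longrightarrow> G i (s i) e = Suc (ys ! i)" by metis
    define env where "env i = (if i < ?m then ys ! i else 0)" for i
    have "ys = map env [0..<?m]"
      using len by (auto simp: env_def intro!: nth_equalityI)
    then obtain t where t: "T t env = Suc y"
      using fy step_functionD(3)[OF f, of env y] by auto
    \<comment> \<open>This budget exceeds those of all inner codes and of \<open>f\<close>.\<close>
    define z where "z = t + (\<Sum>i<?m. s i)"
    have G: "G i z e = Suc (ys ! i)" if "i < ?m" for i
    proof -
      have "s i \<le> z" using member_le_sum[of i "{..<?m}" s] that by (auto simp: z_def)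
      then show ?thesis using step_functionD(2)[OF g[OF that], OF _ s[OF that]] by blast
    qed
    then have "(\<lambda>i. A i z e) = env" by (auto simp: A_def env_def)
    moreover have "T z env = Suc y"
      by (rule step_functionD(2)[OF f, OF _ t]) (simp add: z_def)
    ultimately have "H z e = Suc y" using G by (simp add: H_def)
    then show "\<exists>s. H s e = Suc y" ..
  next
    assume "\<exists>s. H s e = Suc y"
    then obtain s where "H s e = Suc y" ..
    then have pos: "\<And>i. i < ?m \<Longrightarrow> 0 < G i s e" and T: "T s (\<lambda>i. A i s e) = Suc y"
      by (auto simp: H_def split: if_splits)
    have "reval (gs ! i) (map e [0..<k]) (A i s e)" if "i < ?m" for i
      using step_functionD(3)[OF g[OF that], of e "A i s e"] pos[OF that] that
      by (auto simp: A_def intro!: exI[of _ s])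
    then have "list_all2 (\<lambda>g y. reval g (map e [0..<k]) y) gs (map (\<lambda>i. A i s e) [0..<?m])"
      by (simp add: list_all2_conv_all_nth)
    moreover have "reval f (map (\<lambda>i. A i s e) [0..<?m]) y"
      using step_functionD(3)[OF f] T by blast
    ultimately show "reval (Comp f gs) (map e [0..<k]) y"
      unfolding reval_Comp_iff by blast
  qed
  ultimately show ?thesis unfolding step_function_def by blast
qed

text \<open>Every stage of the recursion gets the same budget \<open>s\<close>, and a missing
  result, coded 0, is passed on through all later stages.\<close>

lemma step_function_Prec:
  assumes f: "step_function f k F" and g: "step_function g (Suc (Suc k)) G"
  shows "\<exists>T. step_function (Prec f g) (Suc k) T"
proof -
  define R where "R s n e = rec_nat (F s e)
    (\<lambda>i r. if r = 0 then 0 else G s (case_nat i (case_nat (r - 1) e))) n" for s n e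
  have R_0: "R s 0 e = F s e"
    and R_Suc: "R s (Suc n) e =
      (if R s n e = 0 then 0 else G s (case_nat n (case_nat (R s n e - 1) e)))" for s n e
    by (simp_all add: R_def)
  \<comment> \<open>Inside the recursion index 0 is the stage, 1 the previous result, 2 the budget
    and 3 the number of stages; the parameters start at index 4.\<close>
  have "recursive (\<lambda>e. G (e 2) (case_nat (e 0) (case_nat (e 1 - 1) (\<lambda>i. e (Suc (Suc (Suc (Suc i))))))))"
    by (intro recursive_env_subst[OF step_functionD(1)[OF g], where A =
          "\<lambda>i e. case_nat (e 0) (case_nat (e 1 - 1) (\<lambda>i. e (Suc (Suc (Suc (Suc i)))))) i"])
      (intro recursive_proj recursive_pred recursive_case_nat)+
  then have "recursive (\<lambda>e. R (e 0) (e 1) (\<lambda>i. e (Suc (Suc i))))"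
    unfolding R_def
    by (intro recursive_rec_nat recursive_if recursive_proj recursive_const decidable_eq
        recursive_env_subst[OF step_functionD(1)[OF f]]) (simp_all add: numeral_2_eq_2)
  then have "recursive (\<lambda>e. R (e 0) (e (Suc 0)) (\<lambda>i. e (Suc (Suc i))))" by simp
  moreover have mono: "R s' n e = Suc y" if "s \<le> s'" "R s n e = Suc y" for s s' n e y
    using that(2)
  proof (induction n arbitrary: y)
    case 0
    then show ?case using step_functionD(2)[OF f, OF that(1)] by (simp add: R_0)
  next
    case (Suc n)
    then obtain r where r: "R s n e = Suc r" and y: "G s (case_nat n (case_nat r e)) = Suc y"
      by (cases "R s n e") (auto simp: R_Suc)
    show ?case
      using Suc.IH[OF r] step_functionD(2)[OF g, OF that(1) y] by (simp add: R_Suc)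
  qed
  moreover have R: "reval (Prec f g) (n # map e [0..<k]) y \<longleftrightarrow> (\<exists>s. R s n e = Suc y)" for n e y
  proof (induction n arbitrary: y)
    case 0
    then show ?case by (simp add: reval_Prec_0_iff R_0 step_functionD(3)[OF f])
  next
    case (Suc n)
    have G: "reval g (n # r # map e [0..<k]) y \<longleftrightarrow> (\<exists>s. G s (case_nat n (case_nat r e)) = Suc y)" for r
      using step_functionD(3)[OF g, of "case_nat n (case_nat r e)" y]
      unfolding map_upt_Suc_shift by simp
    show ?case
    proof
      assume "reval (Prec f g) (Suc n # map e [0..<k]) y"
      then obtain r s t where "R s n e = Suc r" "G t (case_nat n (case_nat r e)) = Suc y"
        unfolding reval_Prec_Suc_iff Suc.IH G by blast
      then have "R (s + t) n e = Suc r" "G (s + t) (case_nat n (case_nat r e)) = Suc y"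
        using mono[of s "s + t"] step_functionD(2)[OF g, of t "s + t"] by auto
      then have "R (s + t) (Suc n) e = Suc y" by (simp add: R_Suc)
      then show "\<exists>s. R s (Suc n) e = Suc y" ..
    next
      assume "\<exists>s. R s (Suc n) e = Suc y"
      then obtain s where s: "R s (Suc n) e = Suc y" ..
      then obtain r where "R s n e = Suc r" "G s (case_nat n (case_nat r e)) = Suc y"
        by (cases "R s n e") (auto simp: R_Suc)
      then show "reval (Prec f g) (Suc n # map e [0..<k]) y"
        unfolding reval_Prec_Suc_iff Suc.IH G by blast
    qed
  qed
  ultimately show ?thesis
    unfolding step_function_def map_upt_Suc_shift
    by (intro exI[of _ "\<lambda>s e. R s (e 0) (\<lambda>i. e (Suc i))"]) blast
qed

text \<open>A simulated value 1 means result 0 and a value above 1 means a positive result. So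
  \<open>Z s n e\<close> says that budget \<open>s\<close> suffices to see that \<open>n\<close> is
  the first zero and that all earlier values are defined.\<close>

lemma step_function_Mu:
  assumes f: "step_function f (Suc k) F"
  shows "\<exists>T. step_function (Mu f) k T"
proof -
  define Z where "Z s n e \<longleftrightarrow> F s (case_nat n e) = 1 \<and> (\<forall>m<n. 1 < F s (case_nat m e))" for s n e
  \<comment> \<open>At most one \<open>n\<close> satisfies \<open>Z s n e\<close>, so the sum
    selects it.\<close>
  define T where "T s e = (\<Sum>n<s. if Z s n e then Suc n else 0)" for s e
  have step: "recursive (\<lambda>e. F (S e) (case_nat (N e) (\<lambda>i. e (h i))))"
    if "recursive S" "recursive N" for S N h
    by (intro recursive_env_subst[OF step_functionD(1)[OF f], where A =
          "\<lambda>i e. case_nat (N e) (\<lambda>i. e (h i)) i"])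
      (intro that recursive_proj recursive_case_nat)+
  have "recursive (\<lambda>e. T (e 0) (\<lambda>i. e (Suc i)))"
    unfolding T_def Z_def
    by (intro step recursive_sum recursive_if decidable_conj decidable_eq decidable_ball
        decidable_less recursive_Suc recursive_proj recursive_const)
  moreover have uniq: "n = n'" if "Z s n e" "Z s n' e" for s n n' e
    using that unfolding Z_def by (metis less_irrefl linorder_neqE_nat)
  have T_eq: "T s e = Suc n \<longleftrightarrow> n < s \<and> Z s n e" for s e n
  proof (cases "\<exists>m<s. Z s m e")
    case True
    then obtain m where m: "m < s" "Z s m e" by blast
    have "T s e = (\<Sum>n<s. if n = m then Suc n else 0)"
      unfolding T_def using m uniq by (intro sum.cong) auto
    then have "T s e = Suc m" using m by simp
    then show ?thesis using m uniq by auto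
  next
    case False
    then have "T s e = 0" unfolding T_def by (intro sum.neutral) auto
    then show ?thesis using False by auto
  qed
  have Z_mono: "Z s' n e" if "s \<le> s'" "Z s n e" for s s' n e
  proof -
    have "F s' (case_nat m e) = F s (case_nat m e)" if "0 < F s (case_nat m e)" for m
      using step_functionD(2)[OF f, OF \<open>s \<le> s'\<close>, of "case_nat m e" "F s (case_nat m e) - 1"] that by simp
    then show ?thesis using that(2) unfolding Z_def by (metis less_trans zero_less_one)
  qed
  have "T s' e = Suc y" if "s \<le> s'" "T s e = Suc y" for s s' e y
    using that Z_mono unfolding T_eq by (meson less_le_trans)
  moreover have "reval (Mu f) (map e [0..<k]) n \<longleftrightarrow> (\<exists>s. T s e = Suc n)" for e n
  proof -
    have F: "reval f (m # map e [0..<k]) y \<longleftrightarrow> (\<exists>s. F s (case_nat m e) = Suc y)" for m y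
      using step_functionD(3)[OF f, of "case_nat m e" y] unfolding map_upt_Suc_shift by simp
    have "reval (Mu f) (map e [0..<k]) n \<longleftrightarrow>
        (\<exists>s. F s (case_nat n e) = 1) \<and> (\<forall>m<n. \<exists>s. 1 < F s (case_nat m e))"
      unfolding reval_Mu_iff F by (simp flip: One_nat_def) (metis One_nat_def less_iff_Suc_add plus_1_eq_Suc)
    also have "\<dots> \<longleftrightarrow> (\<exists>s. n < s \<and> Z s n e)"
    proof
      assume "(\<exists>s. F s (case_nat n e) = 1) \<and> (\<forall>m<n. \<exists>s. 1 < F s (case_nat m e))"
      then obtain t s where t: "F t (case_nat n e) = 1"
        and s: "\<And>m. m < n \<Longrightarrow> 1 < F (s m) (case_nat m e)" by metis
      define z where "z = Suc (n + t + (\<Sum>m<n. s m))"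
      have "F z (case_nat n e) = 1"
        using step_functionD(2)[OF f, of t z _ 0] t by (simp add: z_def)
      moreover have "1 < F z (case_nat m e)" if "m < n" for m
      proof -
        have "s m \<le> z" using member_le_sum[of m "{..<n}" s] that by (auto simp: z_def)
        then show ?thesis
          using step_functionD(2)[OF f, of "s m" z "case_nat m e" "F (s m) (case_nat m e) - 1"]
            s[OF that] by simp
      qed
      ultimately show "\<exists>s. n < s \<and> Z s n e"
        unfolding Z_def by (intro exI[of _ z]) (auto simp: z_def)
    qed (auto simp: Z_def)
    finally show ?thesis unfolding T_eq .
  qed
  ultimately show ?thesis unfolding step_function_def by blast
qed

text \<open>The arity \<open>k\<close> is generalized in the induction because subcodes run on
  tuples of other lengths. A code that is undefined at arity \<open>k\<close> gets the constant
  0.\<close>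

lemma step_function_exists: "\<exists>T. step_function f k T"
proof (induction f arbitrary: k)
  case Zero
  show ?case
    by (rule exI[of _ "\<lambda>s e. 1"]) (auto simp: step_function_def reval_Zero_iff recursive_const)
next
  case Succ
  have "map e [0..<k] = [x] \<longleftrightarrow> k = 1 \<and> x = e 0" for e and x :: nat
    by (cases k) (auto simp: map_upt_Suc_shift simp del: upt_Suc)
  then show ?case
    by (intro exI[of _ "\<lambda>s e. if k = 1 then Suc (Suc (e 0)) else 0"])
      (auto simp: step_function_def reval_Succ_iff
        intro!: recursive_if decidable_const recursive_Suc recursive_proj recursive_const)
next
  case (Proj i)
  show ?case
    by (rule exI[of _ "\<lambda>s e. if i < k then Suc (e i) else 0"])
      (auto simp: step_function_def reval_Proj_iff
        intro!: recursive_if decidable_const recursive_Suc recursive_proj recursive_const)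
next
  case (Comp f gs)
  have "\<exists>G. \<forall>i<length gs. step_function (gs ! i) k (G i)"
    by (rule choice[THEN exE, of "\<lambda>i T. i < length gs \<longrightarrow> step_function (gs ! i) k T"])
      (use Comp.IH(2) nth_mem in blast)+
  then show ?case using Comp.IH(1) step_function_Comp by blast
next
  case (Prec f g)
  show ?case
  proof (cases k)
    case 0
    then show ?thesis
      by (intro exI[of _ "\<lambda>s e. 0"]) (auto simp: step_function_def reval_Prec_Nil recursive_const)
  next
    case (Suc m)
    then show ?thesis using Prec.IH step_function_Prec by blast
  qed
next
  case (Mu f)
  then show ?case using step_function_Mu by blast
qed

section \<open>Computable machines as semidecidable relations\<close>

text \<open>A step function turns evaluation into the search for a sufficient budget. Index
  \<open>k\<close>, just past the arguments, holds the claimed value.\<close>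

lemma semidecidable_reval: "semidecidable (\<lambda>e. reval f (map e [0..<k]) (e k))"
proof -
  obtain T where T: "step_function f k T" using step_function_exists by blast
  have "semidecidable (\<lambda>e. \<exists>s. T s e = Suc (e k))"
    using step_functionD(1)[OF T]
    by (intro semidecidable_ex semidecidable_decidable decidable_eq recursive_Suc recursive_proj)
  then show ?thesis by (simp add: step_functionD(3)[OF T])
qed

text \<open>Converse to the previous lemma: \<open>Mu\<close> searches for a bound \<open>W\<close>
  on both a witness and a value, and a bounded search below \<open>W\<close> then recovers the
  value. Functionality of \<open>R\<close> makes the value independent of the bound found.\<close>

lemma reval_of_semidecidable:
  assumes "semidecidable (\<lambda>e. R (e 0) (\<lambda>i. e (Suc i)))"
    and functional: "\<And>y y' e. R y e \<Longrightarrow> R y' e \<Longrightarrow> y = y'"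
  shows "\<exists>f. \<forall>e y. reval f (map e [0..<k]) y \<longleftrightarrow> R y (\<lambda>i. if i < k then e i else 0)"
proof -
  obtain Q where Q: "decidable (\<lambda>e. Q (e 0) (\<lambda>i. e (Suc i)))"
    and "\<And>e. R (e 0) (\<lambda>i. e (Suc i)) \<longleftrightarrow> (\<exists>w. Q w e)"
    using assms(1) unfolding semidecidable_def by auto
  from this(2)[of "case_nat _ _"] have R: "R y e \<longleftrightarrow> (\<exists>w. Q w (case_nat y e))" for y e
    by simp
  have Q': "decidable (\<lambda>e. Q (e i) (case_nat (e j) (\<lambda>i. e (h i))))" for i j h
    by (rule decidable_env_subst[OF Q, where A = "\<lambda>m e. case_nat (e j) (\<lambda>i. e (h i)) m"])
      (intro recursive_proj recursive_case_nat)+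
  define P where "P W e \<longleftrightarrow> (\<exists>w<W. \<exists>y<W. Q w (case_nat y e))" for W e
  \<comment> \<open>The alternative \<open>y = W\<close> only keeps the minimization total; it is
    never the outcome when \<open>P W e\<close> holds.\<close>
  define out where "out W e = (LEAST y. (\<exists>w<W. Q w (case_nat y e)) \<or> y = W)" for W :: nat and e
  have "decidable (\<lambda>e. P (e 0) (\<lambda>i. e (Suc i)))"
    unfolding P_def using Q' by (intro decidable_bex recursive_proj)
  then have "recursive (\<lambda>e. if P (e 0) (\<lambda>i. e (Suc i)) then 0 else 1)"
    by (intro recursive_if recursive_const)
  then obtain k1 where k1: "\<And>k. k \<ge> k1 \<Longrightarrow> \<exists>f. \<forall>e y. reval f (map e [0..<k]) y \<longleftrightarrow>
      y = (if P (e 0) (\<lambda>i. e (Suc i)) then 0 else 1)"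
    unfolding recursive_def by metis
  have "decidable (\<lambda>e. \<not> (\<not> (\<exists>w<e 1. Q w (case_nat (e 0) (\<lambda>i. e (Suc (Suc i))))) \<and> e 0 \<noteq> e 1))"
    using Q' by (intro decidable_not decidable_conj decidable_bex decidable_eq recursive_proj)
  then have "recursive (\<lambda>e. out (e 0) (\<lambda>i. e (Suc i)))"
    unfolding out_def by (intro recursive_Least) auto
  then obtain k2 where k2: "\<And>k. k \<ge> k2 \<Longrightarrow> \<exists>f. \<forall>e y. reval f (map e [0..<k]) y \<longleftrightarrow>
      y = out (e 0) (\<lambda>i. e (Suc i))"
    unfolding recursive_def by metis
  define K where "K = k + k1 + k2"
  obtain p where "\<And>e y. reval p (map e [0..<Suc K]) y \<longleftrightarrow>
      y = (if P (e 0) (\<lambda>i. e (Suc i)) then 0 else 1)"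
    using k1[of "Suc K"] by (auto simp: K_def)
  from this[of "case_nat _ _"]
  have p: "reval p (W # map e [0..<K]) y \<longleftrightarrow> y = (if P W e then 0 else 1)" for W e y
    unfolding map_upt_Suc_shift by simp
  obtain g where "\<And>e y. reval g (map e [0..<Suc K]) y \<longleftrightarrow> y = out (e 0) (\<lambda>i. e (Suc i))"
    using k2[of "Suc K"] by (auto simp: K_def)
  from this[of "case_nat _ _"] have g: "reval g (W # map e [0..<K]) y \<longleftrightarrow> y = out W e" for W e y
    unfolding map_upt_Suc_shift by simp
  have out: "R (out W e) e" if W: "P W e" for W e
  proof -
    obtain y w where y: "y < W" and w: "w < W" "Q w (case_nat y e)"
      using W unfolding P_def by blast
    have "out W e \<le> y" unfolding out_def by (rule Least_le) (use w in blast)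
    moreover have "(\<exists>w<W. Q w (case_nat (out W e) e)) \<or> out W e = W"
      unfolding out_def by (rule LeastI[of _ W]) simp
    ultimately show ?thesis using y R by auto
  qed
  let ?h = "Comp g (Mu p # map Proj [0..<K])"
  have h: "reval ?h (map e [0..<K]) y \<longleftrightarrow> R y e" for e y
  proof -
    have "list_all2 (\<lambda>g y. reval g (map e [0..<K]) y) (map Proj [0..<K]) ys \<longleftrightarrow> ys = map e [0..<K]"
      for ys
      by (auto simp: list_all2_conv_all_nth reval_Proj_iff intro!: nth_equalityI)
    then have "reval ?h (map e [0..<K]) y \<longleftrightarrow> (\<exists>W. reval (Mu p) (map e [0..<K]) W \<and> y = out W e)"
      by (auto simp: reval_Comp_iff list_all2_Cons1 g)
    also have "\<dots> \<longleftrightarrow> (\<exists>W. P W e \<and> (\<forall>m<W. \<not> P m e) \<and> y = out W e)"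
      unfolding reval_Mu_iff p by auto
    also have "\<dots> \<longleftrightarrow> (\<exists>W. P W e \<and> y = out W e)"
      using functional out by (metis exists_least_iff[of "\<lambda>W. P W e"])
    also have "\<dots> \<longleftrightarrow> R y e"
    proof
      assume "R y e"
      then obtain w where "Q w (case_nat y e)" using R by blast
      then have "P (Suc (w + y)) e" unfolding P_def
        by (intro exI[of _ w] conjI exI[of _ y]) auto
      then show "\<exists>W. P W e \<and> y = out W e" using functional[OF \<open>R y e\<close> out] by blast
    qed (use out in blast)
    finally show ?thesis .
  qed
  \<comment> \<open>The code \<open>?h\<close> works at the larger arity \<open>K\<close>; the
    missing arguments are filled with zeros.\<close>
  have pad: "reval (if i < k then Proj i else Zero) (map e [0..<k]) y \<longleftrightarrow>
      y = (if i < k then e i else 0)" for e i y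
    by (simp add: reval_Proj_iff reval_Zero_iff)
  show ?thesis
    by (rule exI[of _ "Comp ?h (map (\<lambda>i. if i < k then Proj i else Zero) [0..<K])"])
      (simp only: reval_Comp_map[where h = "\<lambda>i. if i < k then _ i else 0", OF pad] h simp_thms)
qed

section \<open>Machines on strings as relations on numbers\<close>

lemma string_of_nat_inverse [simp]: "nat_of_string (string_of_nat n) = n"
  unfolding string_of_nat_def by (simp add: bij_is_surj bij_nat_of_string surj_f_inv_f)

lemma nat_of_string_inverse [simp]: "string_of_nat (nat_of_string x) = x"
  unfolding string_of_nat_def by (simp add: bij_is_inj bij_nat_of_string)

lemma string_of_nat_eq_iff [simp]: "string_of_nat m = string_of_nat n \<longleftrightarrow> m = n"
  by (metis string_of_nat_inverse)

lemma computable_iff_semidecidable: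
  "computable D \<longleftrightarrow> semidecidable (\<lambda>e. D (string_of_nat (e 0)) = Some (string_of_nat (e 1)))"
proof
  assume "computable D"
  then obtain f where f: "\<And>p u. D p = Some u \<longleftrightarrow> reval f [nat_of_string p] (nat_of_string u)"
    unfolding computable_def by blast
  show "semidecidable (\<lambda>e. D (string_of_nat (e 0)) = Some (string_of_nat (e 1)))"
    using semidecidable_reval[of f 1] by (simp add: f)
next
  assume *: "semidecidable (\<lambda>e. D (string_of_nat (e 0)) = Some (string_of_nat (e 1)))"
  have "\<exists>f. \<forall>e y. reval f (map e [0..<1]) y \<longleftrightarrow>
      D (string_of_nat ((\<lambda>i. if i < 1 then e i else 0) 0)) = Some (string_of_nat y)"
    by (rule reval_of_semidecidable)
      (use semidecidable_subst2[OF *] in \<open>auto intro: recursive_proj\<close>)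
  then obtain f where f: "\<forall>(e::nat \<Rightarrow> nat) y. reval f [e 0] y \<longleftrightarrow> D (string_of_nat (e 0)) = Some (string_of_nat y)"
    by auto
  show "computable D" unfolding computable_def
    using f[rule_format, of "\<lambda>i. nat_of_string _"] by (intro exI[of _ f]) simp
qed

lemma computable2_iff_semidecidable:
  "computable2 M \<longleftrightarrow> semidecidable
    (\<lambda>e. M (string_of_nat (e 0)) (string_of_nat (e 1)) = Some (string_of_nat (e 2)))"
proof
  assume "computable2 M"
  then obtain f where f: "\<And>p v u. M p v = Some u \<longleftrightarrow>
      reval f [nat_of_string p, nat_of_string v] (nat_of_string u)"
    unfolding computable2_def by blast
  show "semidecidable (\<lambda>e. M (string_of_nat (e 0)) (string_of_nat (e 1)) = Some (string_of_nat (e 2)))"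
    using semidecidable_reval[of f 2] by (simp add: f upt_rec numeral_2_eq_2)
next
  assume *: "semidecidable
    (\<lambda>e. M (string_of_nat (e 0)) (string_of_nat (e 1)) = Some (string_of_nat (e 2)))"
  have "\<exists>f. \<forall>e y. reval f (map e [0..<2]) y \<longleftrightarrow>
      M (string_of_nat ((\<lambda>i. if i < 2 then e i else 0) 0))
        (string_of_nat ((\<lambda>i. if i < 2 then e i else 0) 1)) = Some (string_of_nat y)"
    by (rule reval_of_semidecidable)
      (use semidecidable_subst3[OF *] in \<open>auto intro: recursive_proj\<close>)
  then obtain f where f: "\<forall>(e::nat \<Rightarrow> nat) y. reval f [e 0, e 1] y \<longleftrightarrow>
      M (string_of_nat (e 0)) (string_of_nat (e 1)) = Some (string_of_nat y)"
    by (auto simp: upt_rec numeral_2_eq_2)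
  show "computable2 M" unfolding computable2_def
    using f[rule_format, of "\<lambda>i. nat_of_string (if i = 0 then _ else _)"] by (intro exI[of _ f]) simp
qed

text \<open>Later machines are specified by functional semidecidable relations on numbers, without
  writing codes.\<close>

lemma obtain_computable:
  assumes "semidecidable (\<lambda>e. R (e 0) (e 1))" and "\<And>x u u'. R x u \<Longrightarrow> R x u' \<Longrightarrow> u = u'"
  obtains D where "computable D"
    and "\<And>p u. D p = Some u \<longleftrightarrow> R (nat_of_string p) (nat_of_string u)"
proof -
  define D where "D p = (if \<exists>u. R (nat_of_string p) u
    then Some (string_of_nat (THE u. R (nat_of_string p) u)) else None)" for p
  have D: "D p = Some u \<longleftrightarrow> R (nat_of_string p) (nat_of_string u)" for p u
  proof
    assume "D p = Some u"
    then have "\<exists>u. R (nat_of_string p) u" and u: "u = string_of_nat (THE u. R (nat_of_string p) u)"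
      by (auto simp: D_def split: if_splits)
    then have "\<exists>!u. R (nat_of_string p) u" using assms(2) by blast
    from theI'[OF this] show "R (nat_of_string p) (nat_of_string u)" by (simp add: u)
  next
    assume R: "R (nat_of_string p) (nat_of_string u)"
    then have "(THE u. R (nat_of_string p) u) = nat_of_string u" using assms(2) by blast
    then show "D p = Some u" using R by (auto simp: D_def)
  qed
  moreover have "computable D" unfolding computable_iff_semidecidable using assms(1) by (simp add: D)
  ultimately show thesis using that by blast
qed

lemma obtain_computable2:
  assumes "semidecidable (\<lambda>e. R (e 0) (e 1) (e 2))"
    and "\<And>x v u u'. R x v u \<Longrightarrow> R x v u' \<Longrightarrow> u = u'"
  obtains M where "computable2 M"
    and "\<And>p v u. M p v = Some u \<longleftrightarrow> R (nat_of_string p) (nat_of_string v) (nat_of_string u)"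
proof -
  define M where "M p v = (if \<exists>u. R (nat_of_string p) (nat_of_string v) u
    then Some (string_of_nat (THE u. R (nat_of_string p) (nat_of_string v) u)) else None)" for p v
  have M: "M p v = Some u \<longleftrightarrow> R (nat_of_string p) (nat_of_string v) (nat_of_string u)" for p v u
  proof
    assume "M p v = Some u"
    then have "\<exists>u. R (nat_of_string p) (nat_of_string v) u"
      and u: "u = string_of_nat (THE u. R (nat_of_string p) (nat_of_string v) u)"
      by (auto simp: M_def split: if_splits)
    then have "\<exists>!u. R (nat_of_string p) (nat_of_string v) u" using assms(2) by blast
    from theI'[OF this] show "R (nat_of_string p) (nat_of_string v) (nat_of_string u)"
      by (simp add: u)
  next
    assume R: "R (nat_of_string p) (nat_of_string v) (nat_of_string u)"
    then have "(THE u. R (nat_of_string p) (nat_of_string v) u) = nat_of_string u"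
      using assms(2) by blast
    then show "M p v = Some u" using R by (auto simp: M_def)
  qed
  moreover have "computable2 M" unfolding computable2_iff_semidecidable using assms(1) by (simp add: M)
  ultimately show thesis using that by blast
qed

section \<open>Arithmetic of the string numbering\<close>

lemma nat_of_string_append:
  "nat_of_string (p @ q) = nat_of_string p * 2 ^ length q + nat_of_string q"
proof (induction q rule: rev_induct)
  case (snoc d q)
  have "nat_of_string (p @ q @ [d]) = 2 * nat_of_string (p @ q) + (if d then 2 else 1)"
    by (simp flip: append_assoc)
  then show ?case by (simp add: snoc.IH)
qed simp

text \<open>The successor of the number of \<open>p\<close> has the binary expansion 1 followed by
  \<open>p\<close>, hence \<open>length p + 1\<close> digits.\<close>

lemma Suc_nat_of_string_bounds:
  "2 ^ length p \<le> Suc (nat_of_string p) \<and> Suc (nat_of_string p) < 2 ^ Suc (length p)"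
  by (induction p rule: rev_induct) auto

lemma length_le_iff: "length p \<le> m \<longleftrightarrow> Suc (nat_of_string p) < 2 ^ Suc m"
proof
  assume "length p \<le> m"
  then have "(2::nat) ^ Suc (length p) \<le> 2 ^ Suc m" by (intro power_increasing) auto
  then show "Suc (nat_of_string p) < 2 ^ Suc m" using Suc_nat_of_string_bounds[of p] by linarith
next
  assume "Suc (nat_of_string p) < 2 ^ Suc m"
  then have "(2::nat) ^ length p < 2 ^ Suc m" using Suc_nat_of_string_bounds[of p] by linarith
  then have "length p < Suc m" by (rule power_less_imp_less_exp[rotated]) simp
  then show "length p \<le> m" by simp
qed

lemma recursive_length:
  assumes "recursive F"
  shows "recursive (\<lambda>e. length (string_of_nat (F e)))"
proof -
  have "(LEAST l. Suc n < 2 ^ Suc l) = length (string_of_nat n)" for n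
    by (rule Least_equality) (metis length_le_iff order_refl string_of_nat_inverse)+
  moreover have "recursive (\<lambda>e. LEAST l. Suc (e 0) < 2 ^ Suc l)"
    by (intro recursive_Least decidable_less recursive_Suc recursive_power recursive_const
        recursive_proj) (metis length_le_iff order_refl string_of_nat_inverse)
  ultimately have "recursive (\<lambda>e. length (string_of_nat (e 0)))" by simp
  then show ?thesis using assms by (rule recursive_subst1)
qed

text \<open>The code supplied by \<open>computable2\<close> is for exactly two arguments; composing
  it with two projections gives codes at all larger arities.\<close>

lemma recursive_pair:
  assumes "computable2 (\<lambda>x y. Some (pair x y))" "recursive A" "recursive B"
  shows "recursive (\<lambda>e. nat_of_string (pair (string_of_nat (A e)) (string_of_nat (B e))))"
proof -
  obtain f where f: "\<And>x y z. pair x y = z \<longleftrightarrow>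
      reval f [nat_of_string x, nat_of_string y] (nat_of_string z)"
    using assms(1) unfolding computable2_def by auto
  have reval_f: "reval f [x, y] z \<longleftrightarrow> z = nat_of_string (pair (string_of_nat x) (string_of_nat y))" for x y z
    using f[of "string_of_nat x" "string_of_nat y" "string_of_nat z"] by auto
  have "recursive (\<lambda>e. nat_of_string (pair (string_of_nat (e 0)) (string_of_nat (e 1))))"
    unfolding recursive_def
    by (intro exI[of _ 2] allI impI exI[of _ "Comp f [Proj 0, Proj 1]"])
      (auto simp: reval_Comp_iff list_all2_Cons1 reval_Proj_iff reval_f)
  from recursive_subst2[where h = "\<lambda>x y. nat_of_string (pair (string_of_nat x) (string_of_nat y))",
      OF this assms(2,3)]
  show ?thesis .
qed

section \<open>The upper bound on the complexity of a pair\<close>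

lemma semidecidable_computable:
  assumes "computable D" "recursive A" "recursive B"
  shows "semidecidable (\<lambda>e. D (string_of_nat (A e)) = Some (string_of_nat (B e)))"
  using assms unfolding computable_iff_semidecidable
  by (rule semidecidable_subst2[where h = "\<lambda>x u. D (string_of_nat x) = Some (string_of_nat u)"])

lemma semidecidable_computable2:
  assumes "computable2 M" "recursive A" "recursive B" "recursive C"
  shows "semidecidable (\<lambda>e. M (string_of_nat (A e)) (string_of_nat (B e)) = Some (string_of_nat (C e)))"
  using assms unfolding computable2_iff_semidecidable
  by (rule semidecidable_subst3[where h =
        "\<lambda>x v u. M (string_of_nat x) (string_of_nat v) = Some (string_of_nat u)"])

lemma complexity_le: "D p = Some u \<Longrightarrow> complexity D u \<le> length p"
  unfolding complexity_def by (rule Least_le) blast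

lemma complexity_attained:
  assumes "\<exists>p. D p = Some u"
  obtains p where "D p = Some u" "length p = complexity D u"
proof -
  have "\<exists>p. D p = Some u \<and> length p = complexity D u"
    unfolding complexity_def by (rule LeastI_ex) (use assms in blast)
  then show thesis using that by blast
qed

lemma complexity_le_of_optimal:
  assumes "optimal_plain U" "computable D"
  obtains c where "\<And>p u. D p = Some u \<Longrightarrow> complexity U u \<le> length p + c"
proof -
  obtain c where "\<And>p u. D p = Some u \<Longrightarrow> \<exists>q. U q = Some u \<and> length q \<le> length p + c"
    using assms unfolding optimal_plain_def by blast
  then show thesis using that complexity_le order_trans by meson
qed

section \<open>Unary headers and the excess\<close>

lemma unary_header_inject:
  "replicate h True @ False # s = replicate h' True @ False # s' \<longleftrightarrow> h = h' \<and> s = s'"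
proof (induction h arbitrary: h')
  case 0
  then show ?case by (cases h') auto
next
  case (Suc h)
  then show ?case by (cases h') auto
qed

text \<open>Strings are base 2 numerals with digits 1 and 2, so \<open>h\<close> digits 2 give
  \<open>2 ^ Suc h - 2\<close>, and a further digit 1 gives \<open>2 ^ Suc (Suc h) - 3\<close>. The
  closed form makes the decoding of headers visibly recursive.\<close>

lemma nat_of_string_unary_header:
  "nat_of_string (replicate h True @ False # s) =
    (2 ^ Suc (Suc h) - 3) * 2 ^ length s + nat_of_string s"
proof -
  have *: "nat_of_string (replicate h True) = 2 ^ Suc h - 2" for h
  proof (induction h)
    case (Suc h)
    have "nat_of_string (replicate (Suc h) True) = nat_of_string (replicate h True @ [True])"
      by (simp only: replicate_Suc replicate_append_same)
    \<comment> \<open>Writing the power as a successor shows that the subtractions do not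
      truncate.\<close>
    moreover obtain m where "(2::nat) ^ h = Suc m"
      by (metis not0_implies_Suc power_not_zero zero_neq_numeral)
    ultimately show ?case using Suc.IH by simp
  qed simp
  moreover obtain m where "(2::nat) ^ h = Suc m"
    by (metis not0_implies_Suc power_not_zero zero_neq_numeral)
  ultimately have "nat_of_string (replicate h True @ [False]) = 2 ^ Suc (Suc h) - 3" by simp
  then show ?thesis using nat_of_string_append[of "replicate h True @ [False]" s] by simp
qed

text \<open>A machine with \<open>d\<close> built in reads \<open>h\<close> from the header and
  \<open>length p + length q\<close> from the rest, which determines \<open>n\<close>. Since the
  domain of \<open>V\<close> under condition \<open>n\<close> is prefix-free, the end of
  \<open>p\<close> is then determined as well. The constant may depend on \<open>d\<close>.\<close>

lemma complexity_pair_le_half_excess: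
  assumes U: "optimal_plain U" and W: "computable2 W" and V: "prefix_machine V"
    and pair: "computable2 (\<lambda>x y. Some (pair x y))"
  obtains c where "\<And>p q a b n h.
    V p (string_of_nat n) = Some a \<Longrightarrow> W q (pair a (string_of_nat n)) = Some b \<Longrightarrow>
    n = length p + length q + 2 * h + d \<Longrightarrow>
    complexity U (pair a b) \<le> h + length p + length q + c"
proof -
  define pr where "pr x y = nat_of_string (pair (string_of_nat x) (string_of_nat y))" for x y
  define len where "len x = length (string_of_nat x)" for x
  \<comment> \<open>The machine is described on numbers first, where the closure rules give
    semidecidability; \<open>R_iff\<close> translates it back to strings.\<close>
  define R where "R x u \<longleftrightarrow> (\<exists>h p q a b.
      x = (2 ^ Suc (Suc h) - 3) * 2 ^ (len p + len q) + (p * 2 ^ len q + q) \<and>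
      V (string_of_nat p) (string_of_nat (len p + len q + 2 * h + d)) = Some (string_of_nat a) \<and>
      W (string_of_nat q) (string_of_nat (pr a (len p + len q + 2 * h + d))) =
        Some (string_of_nat b) \<and>
      u = pr a b)" for x u
  have rec_pr: "recursive A \<Longrightarrow> recursive B \<Longrightarrow> recursive (\<lambda>e. pr (A e) (B e))" for A B
    unfolding pr_def by (rule recursive_pair[OF pair])
  have rec_len: "recursive A \<Longrightarrow> recursive (\<lambda>e. len (A e))" for A
    unfolding len_def by (rule recursive_length)
  have V': "computable2 V" using V by (simp add: prefix_machine_def)
  have semi: "semidecidable (\<lambda>e. R (e 0) (e 1))"
    unfolding R_def
    by (intro semidecidable_ex semidecidable_conj semidecidable_decidable[OF decidable_eq]
        semidecidable_computable2[OF V'] semidecidable_computable2[OF W] rec_pr rec_len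
        recursive_add recursive_mult recursive_power recursive_diff recursive_Suc recursive_proj
        recursive_const)
  have R_iff: "R x u \<longleftrightarrow> (\<exists>h p q a b n.
      string_of_nat x = replicate h True @ False # p @ q \<and> n = length p + length q + 2 * h + d \<and>
      V p (string_of_nat n) = Some a \<and> W q (pair a (string_of_nat n)) = Some b \<and>
      u = nat_of_string (pair a b))" for x u
  proof -
    have code: "x = (2 ^ Suc (Suc h) - 3) * 2 ^ (len p + len q) + (p * 2 ^ len q + q) \<longleftrightarrow>
        string_of_nat x = replicate h True @ False # string_of_nat p @ string_of_nat q" for h p q
    proof -
      have "nat_of_string (replicate h True @ False # string_of_nat p @ string_of_nat q) =
          (2 ^ Suc (Suc h) - 3) * 2 ^ (len p + len q) + (p * 2 ^ len q + q)"
        by (simp only: nat_of_string_unary_header nat_of_string_append[of "string_of_nat p"]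
            length_append len_def string_of_nat_inverse)
      then show ?thesis by (metis nat_of_string_inverse string_of_nat_inverse)
    qed
    show ?thesis unfolding R_def code
    proof
      assume "\<exists>h p q a b n. string_of_nat x = replicate h True @ False # p @ q \<and>
        n = length p + length q + 2 * h + d \<and> V p (string_of_nat n) = Some a \<and>
        W q (pair a (string_of_nat n)) = Some b \<and> u = nat_of_string (pair a b)"
      then obtain h p q a b n where "string_of_nat x = replicate h True @ False # p @ q"
        "n = length p + length q + 2 * h + d" "V p (string_of_nat n) = Some a"
        "W q (pair a (string_of_nat n)) = Some b" "u = nat_of_string (pair a b)"
        by blast
      then show "\<exists>h p q a b. string_of_nat x = replicate h True @ False # string_of_nat p @ string_of_nat q \<and>
        V (string_of_nat p) (string_of_nat (len p + len q + 2 * h + d)) = Some (string_of_nat a) \<and>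
        W (string_of_nat q) (string_of_nat (pr a (len p + len q + 2 * h + d))) =
          Some (string_of_nat b) \<and> u = pr a b"
        by (intro exI[of _ h] exI[of _ "nat_of_string p"] exI[of _ "nat_of_string q"]
            exI[of _ "nat_of_string a"] exI[of _ "nat_of_string b"]) (simp add: len_def pr_def)
    next
      assume "\<exists>h p q a b. string_of_nat x = replicate h True @ False # string_of_nat p @ string_of_nat q \<and>
        V (string_of_nat p) (string_of_nat (len p + len q + 2 * h + d)) = Some (string_of_nat a) \<and>
        W (string_of_nat q) (string_of_nat (pr a (len p + len q + 2 * h + d))) =
          Some (string_of_nat b) \<and> u = pr a b"
      then show "\<exists>h p q a b n. string_of_nat x = replicate h True @ False # p @ q \<and>
        n = length p + length q + 2 * h + d \<and> V p (string_of_nat n) = Some a \<and>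
        W q (pair a (string_of_nat n)) = Some b \<and> u = nat_of_string (pair a b)"
        unfolding len_def pr_def nat_of_string_inverse by blast
    qed
  qed
  have functional: "u = u'" if R: "R x u" and R': "R x u'" for x u u'
  proof -
    obtain h p q a b n where 1: "string_of_nat x = replicate h True @ False # p @ q"
      "n = length p + length q + 2 * h + d" "V p (string_of_nat n) = Some a"
      "W q (pair a (string_of_nat n)) = Some b" "u = nat_of_string (pair a b)"
      using R unfolding R_iff by blast
    obtain h' p' q' a' b' n' where 2: "string_of_nat x = replicate h' True @ False # p' @ q'"
      "n' = length p' + length q' + 2 * h' + d" "V p' (string_of_nat n') = Some a'"
      "W q' (pair a' (string_of_nat n')) = Some b'" "u' = nat_of_string (pair a' b')"
      using R' unfolding R_iff by blast
    have h: "h = h'" and pq: "p @ q = p' @ q'"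
      using 1(1) 2(1) by (auto simp: unary_header_inject)
    then have n: "n = n'" using 1(2) 2(2) by (metis length_append)
    \<comment> \<open>Both are prefixes of the same string and halt under the same condition, as
      \<open>n = n'\<close> is already known.\<close>
    have "prefix p p' \<or> prefix p' p"
      using pq by (metis prefixI prefix_same_cases)
    then have "p = p'"
      using V 1(3) 2(3) n unfolding prefix_machine_def prefix_free_def by blast
    then show ?thesis using 1 2 n pq by auto
  qed
  obtain D where "computable D"
    and D: "\<And>p u. D p = Some u \<longleftrightarrow> R (nat_of_string p) (nat_of_string u)"
    by (rule obtain_computable[of R]) (use semi functional in blast)+
  then obtain c where c: "\<And>p u. D p = Some u \<Longrightarrow> complexity U u \<le> length p + c"
    using complexity_le_of_optimal[OF U] by blast
  show thesis
  \<comment> \<open>The additional 1 pays for the digit \<open>False\<close> that ends the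
    header.\<close>
  proof (rule that[of "Suc c"])
    fix p q a b n h
    assume "V p (string_of_nat n) = Some a" "W q (pair a (string_of_nat n)) = Some b"
      "n = length p + length q + 2 * h + d"
    then have "D (replicate h True @ False # p @ q) = Some (pair a b)"
      unfolding D R_iff by (metis nat_of_string_inverse)
    from c[OF this] show "complexity U (pair a b) \<le> h + length p + length q + Suc c" by simp
  qed
qed

text \<open>With excess \<open>x\<close>, the half-excess bound reads
  \<open>x \<le> x div 2 + O(1)\<close>, which bounds \<open>x\<close>.\<close>

lemma complexity_pair_upper_bound:
  assumes U: "optimal_plain U" and W: "optimal_cond_plain W" and V: "optimal_cond_prefix V"
    and pair: "pair_encoding pair"
  obtains c where "\<And>a b n. n = complexity U (pair a b) \<Longrightarrow>
    n \<le> cond_complexity V a (string_of_nat n) + cond_complexity W b (pair a (string_of_nat n)) + c"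
proof -
  have W': "computable2 W" and V': "prefix_machine V" and p': "computable2 (\<lambda>x y. Some (pair x y))"
    using W V pair by (auto simp: optimal_cond_plain_def optimal_cond_prefix_def pair_encoding_def)
  have "\<forall>d. \<exists>c. \<forall>p q a b n h.
    V p (string_of_nat n) = Some a \<longrightarrow> W q (pair a (string_of_nat n)) = Some b \<longrightarrow>
    n = length p + length q + 2 * h + d \<longrightarrow>
    complexity U (pair a b) \<le> h + length p + length q + c"
    by (metis complexity_pair_le_half_excess[OF U W' V' p'])
  then obtain c where c: "\<And>d p q a b n h.
    V p (string_of_nat n) = Some a \<Longrightarrow> W q (pair a (string_of_nat n)) = Some b \<Longrightarrow>
    n = length p + length q + 2 * h + d \<Longrightarrow>
    complexity U (pair a b) \<le> h + length p + length q + c d" by metis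
  show thesis
  proof (rule that[of "2 * (c 0 + c 1) + 1"])
    fix a b n assume n: "n = complexity U (pair a b)"
    obtain p where p: "V p (string_of_nat n) = Some a" "length p = cond_complexity V a (string_of_nat n)"
      using complexity_attained[OF optimal_cond_prefix_has_program[OF V]]
      unfolding cond_complexity_def by blast
    obtain q where q: "W q (pair a (string_of_nat n)) = Some b"
      "length q = cond_complexity W b (pair a (string_of_nat n))"
      using complexity_attained[OF optimal_cond_plain_has_program[OF W]]
      unfolding cond_complexity_def by blast
    show "n \<le> cond_complexity V a (string_of_nat n) + cond_complexity W b (pair a (string_of_nat n)) +
        (2 * (c 0 + c 1) + 1)"
    proof (cases "n \<le> length p + length q")
      case False
      define x where "x = n - (length p + length q)"
      have x: "n = length p + length q + x" using False by (simp add: x_def)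
      \<comment> \<open>The parity of the excess is built into the machine, so only two machines and
        two constants occur.\<close>
      have "n = length p + length q + 2 * (x div 2) + x mod 2" using x by simp
      from c[OF p(1) q(1) this] have "n \<le> x div 2 + length p + length q + c (x mod 2)"
        by (simp add: n)
      moreover have "c (x mod 2) \<le> c 0 + c 1"
        by (cases "even x") (auto simp: even_iff_mod_2_eq_zero odd_iff_mod_2_eq_one)
      ultimately have "n \<le> x div 2 + length p + length q + (c 0 + c 1)" by linarith
      then have "x \<le> 2 * (c 0 + c 1) + 1" using x by presburger
      then show ?thesis using x p(2) q(2) by linarith
    qed (use p q in simp)
  qed
qed

section \<open>Online allocation of codewords\<close>

text \<open>At stage \<open>i\<close> an event with value \<open>A i\<close> happens if
  \<open>E i\<close> holds. Stage \<open>w\<close> itself is excluded, so for an event at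
  \<open>w\<close> the count of its own value is its index, from 0, among the events of that
  value.\<close>

definition event_count :: "(nat \<Rightarrow> bool) \<Rightarrow> (nat \<Rightarrow> nat) \<Rightarrow> nat \<Rightarrow> nat \<Rightarrow> nat" where
  "event_count E A a w = (\<Sum>i<w. if E i \<and> A i = a then 1 else 0)"

text \<open>The bound \<open>j < m\<close> excludes no power of two and keeps the test a bounded
  search, hence recursive.\<close>

definition request :: "(nat \<Rightarrow> bool) \<Rightarrow> (nat \<Rightarrow> nat) \<Rightarrow> nat \<Rightarrow> nat" where
  "request E A w = (let m = Suc (event_count E A (A w) w) in
    if E w \<and> (\<exists>j<m. m = 2 ^ j) then m else 0)"

definition offset :: "(nat \<Rightarrow> bool) \<Rightarrow> (nat \<Rightarrow> nat) \<Rightarrow> nat \<Rightarrow> nat" where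
  "offset E A w = (\<Sum>i<w. 2 * request E A i)"

text \<open>
  \<open>Suc x\<close> is the binary number with digits 1 followed by the string number \<open>x\<close>, so the interval to be
  allocated is the one from \<open>2 ^ N\<close> to \<open>2 ^ Suc N\<close>, and \<open>Suc x\<close> is the start of the reserved piece
  divided by \<open>2 ^ j\<close>, rounded up.
\<close>

definition codeword :: "(nat \<Rightarrow> bool) \<Rightarrow> (nat \<Rightarrow> nat) \<Rightarrow> nat \<Rightarrow> nat \<Rightarrow> nat \<Rightarrow> nat \<Rightarrow> bool" where
  "codeword E A N x w j \<longleftrightarrow> E w \<and> Suc (event_count E A (A w) w) = 2 ^ j \<and>
    2 ^ N + offset E A w \<le> 2 ^ j * Suc x \<and> 2 ^ j * Suc x < 2 ^ N + offset E A w + 2 ^ j"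

section \<open>Counting events of a given value\<close>

lemma event_count_Suc:
  "event_count E A a (Suc w) = event_count E A a w + (if E w \<and> A w = a then 1 else 0)"
  by (simp add: event_count_def)

lemma event_count_mono: "w \<le> w' \<Longrightarrow> event_count E A a w \<le> event_count E A a w'"
  by (rule lift_Suc_mono_le) (simp add: event_count_Suc)

lemma event_count_strict_mono:
  assumes "E w" "A w = a" "w < w'"
  shows "event_count E A a w < event_count E A a w'"
  using event_count_mono[of "Suc w" w' E A a] assms by (simp add: event_count_Suc)

lemma event_count_inject:
  assumes "E w" "E w'" "A w = a" "A w' = a" "event_count E A a w = event_count E A a w'"
  shows "w = w'"
  using assms event_count_strict_mono[of E _ A a] by (metis less_irrefl linorder_neqE_nat)

text \<open>The count starts at 0 and rises by at most one per stage, so it must leave the value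
  \<open>c\<close> at some event.\<close>

lemma event_count_attained:
  "c < event_count E A a w \<Longrightarrow> \<exists>w'. E w' \<and> A w' = a \<and> event_count E A a w' = c"
proof (induction w)
  case (Suc w)
  then show ?case by (cases "c < event_count E A a w") (auto simp: event_count_Suc split: if_splits)
qed (simp add: event_count_def)

section \<open>The total size of all requests\<close>

lemma request_eq:
  "request E A w = (if E w \<and> (\<exists>j. Suc (event_count E A (A w) w) = 2 ^ j)
    then Suc (event_count E A (A w) w) else 0)"
proof -
  have "(\<exists>j. m = 2 ^ j) \<longleftrightarrow> (\<exists>j<m. m = 2 ^ j)" for m :: nat
    using less_exp by auto
  then show ?thesis by (simp add: request_def Let_def)
qed

text \<open>Only powers of two below \<open>2 ^ j\<close> contribute, each once, and
  \<open>1 + 2 + ... + 2 ^ (j - 1) < 2 ^ j\<close>.\<close>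

lemma sum_powers_of_two_less:
  fixes c j :: nat
  shows "c < 2 ^ j \<Longrightarrow> (\<Sum>i<c. if \<exists>j. Suc i = 2 ^ j then Suc i else 0) < 2 ^ j"
proof (induction c arbitrary: j)
  case (Suc c)
  show ?case
  proof (cases "\<exists>i. Suc c = 2 ^ i")
    case True
    then obtain i where i: "Suc c = 2 ^ i" by blast
    then have "i < j" using Suc.prems by (metis power_less_imp_less_exp one_less_numeral_iff semiring_norm(76))
    then have "(2::nat) ^ Suc i \<le> 2 ^ j" by (intro power_increasing) auto
    moreover have "(\<Sum>i<c. if \<exists>j. Suc i = 2 ^ j then Suc i else 0) < 2 ^ i"
      by (rule Suc.IH) (use i in linarith)
    moreover have "(\<Sum>i<Suc c. if \<exists>j. Suc i = 2 ^ j then Suc i else 0) =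
        (\<Sum>i<c. if \<exists>j. Suc i = 2 ^ j then Suc i else 0) + Suc c"
      using True by simp
    ultimately show ?thesis using i by simp
  next
    case False
    then show ?thesis using Suc.IH[of j] Suc.prems by simp
  qed
qed simp

lemma power_of_two_interval:
  fixes c :: nat
  assumes "0 < c"
  obtains l where "2 ^ l \<le> c" "c < 2 ^ Suc l"
  using Suc_nat_of_string_bounds[of "string_of_nat (c - 1)"] assms by auto

lemma sum_powers_of_two_le:
  fixes c :: nat
  shows "(\<Sum>i<c. if \<exists>j. Suc i = 2 ^ j then Suc i else 0) \<le> 2 * c"
proof (cases "c = 0")
  case False
  then obtain l where "2 ^ l \<le> c" "c < 2 ^ Suc l" using power_of_two_interval by blast
  then show ?thesis using sum_powers_of_two_less[of c "Suc l"] by simp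
qed simp

text \<open>Grouped by value, the requests of a value with \<open>c\<close> events add up to at most
  \<open>2 * c\<close>; the counts of all values add up to at most the number of events.\<close>

lemma sum_requests_le:
  assumes "finite {w. E w}"
  shows "(\<Sum>i<w. request E A i) \<le> 2 * card {w. E w}"
proof -
  have per_value: "(\<Sum>i<w. if A i = a then request E A i else 0) =
      (\<Sum>i<event_count E A a w. if \<exists>j. Suc i = 2 ^ j then Suc i else 0)" for a w
  proof (induction w)
    case 0
    then show ?case by (simp add: event_count_def)
  next
    case (Suc w)
    then show ?case by (cases "E w \<and> A w = a") (auto simp: event_count_Suc request_eq)
  qed
  \<comment> \<open>For each \<open>i\<close> exactly one \<open>a\<close> contributes.\<close>
  have "(\<Sum>i<w. request E A i) = (\<Sum>i<w. \<Sum>a\<in>A ` {..<w}. if A i = a then request E A i else 0)"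
    by (intro sum.cong) (auto simp: sum.delta)
  also have "\<dots> = (\<Sum>a\<in>A ` {..<w}. \<Sum>i<w. if A i = a then request E A i else 0)"
    by (rule sum.swap)
  also have "\<dots> \<le> (\<Sum>a\<in>A ` {..<w}. 2 * event_count E A a w)"
    unfolding per_value by (intro sum_mono sum_powers_of_two_le)
  also have "\<dots> = 2 * (\<Sum>i<w. \<Sum>a\<in>A ` {..<w}. if E i \<and> A i = a then 1 else 0)"
    unfolding event_count_def sum_distrib_left[symmetric] by (subst sum.swap) simp
  also have "(\<Sum>i<w. \<Sum>a\<in>A ` {..<w}. if E i \<and> A i = a then 1 else 0 :: nat) =
      (\<Sum>i<w. if E i then 1 else 0)"
    by (intro sum.cong) (auto simp: sum.delta)
  also have "\<dots> = card {i. i < w \<and> E i}"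
    by (simp add: sum.If_cases lessThan_def Collect_conj_eq)
  also have "\<dots> \<le> card {w. E w}"
    using assms by (intro card_mono) auto
  finally show ?thesis by simp
qed

section \<open>Placement of the blocks\<close>

lemma offset_mono: "w \<le> w' \<Longrightarrow> offset E A w \<le> offset E A w'"
  by (rule lift_Suc_mono_le) (simp add: offset_def)

lemma offset_codeword:
  assumes "codeword E A N x w j" "w < w'"
  shows "offset E A w + 2 * 2 ^ j \<le> offset E A w'"
proof -
  have "request E A w = 2 ^ j" using assms(1) by (auto simp: codeword_def request_eq)
  then have "offset E A (Suc w) = offset E A w + 2 * 2 ^ j" by (simp add: offset_def)
  then show ?thesis using offset_mono[of "Suc w" w' E A] assms(2) by simp
qed

text \<open>Requests total at most \<open>2 * 2 ^ Suc n\<close>, and doubling them for alignment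
  gives \<open>2 ^ (n + 3)\<close>; this is where the 3 comes from. Thus the block stays between
  \<open>2 ^ (n + 3)\<close> and \<open>2 * 2 ^ (n + 3)\<close>, and division by
  \<open>2 ^ j\<close> fixes the number of binary digits of \<open>Suc x\<close>.\<close>

lemma codeword_length:
  assumes cw: "codeword E A (n + 3) x w j" and fin: "finite {w. E w}" and "card {w. E w} \<le> 2 ^ Suc n"
  shows "length (string_of_nat x) + j = n + 3"
proof -
  have "offset E A (Suc w) = 2 * (\<Sum>i<Suc w. request E A i)"
    unfolding offset_def sum_distrib_left ..
  also have "\<dots> \<le> 2 ^ (n + 3)"
    using sum_requests_le[OF fin, of A "Suc w"] assms(3) by (simp add: power_add)
  finally have off: "offset E A w + 2 * 2 ^ j \<le> 2 ^ (n + 3)"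
    using offset_codeword[OF cw, of "Suc w"] by simp
  then have "(2::nat) ^ j \<le> 2 ^ (n + 3)" by linarith
  then have j: "j \<le> n + 3" by (rule power_le_imp_le_exp[rotated]) simp
  let ?L = "n + 3 - j" and ?l = "length (string_of_nat x)"
  have split: "(2::nat) ^ (n + 3) = 2 ^ j * 2 ^ ?L"
    using j by (simp flip: power_add)
  have "2 ^ j * 2 ^ ?L \<le> 2 ^ j * Suc x" "2 ^ j * Suc x < 2 ^ j * 2 ^ Suc ?L"
    using cw off split unfolding codeword_def by simp_all
  then have "2 ^ ?L \<le> Suc x" "Suc x < 2 ^ Suc ?L" by (simp_all only: mult_le_cancel1 mult_less_cancel1)
  moreover have "2 ^ ?l \<le> Suc x" "Suc x < 2 ^ Suc ?l"
    using Suc_nat_of_string_bounds[of "string_of_nat x"] by simp_all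
  ultimately have "(2::nat) ^ ?L < 2 ^ Suc ?l" "(2::nat) ^ ?l < 2 ^ Suc ?L" by linarith+
  then have "?L < Suc ?l" "?l < Suc ?L"
    by (auto dest: power_less_imp_less_exp[rotated] simp del: power_Suc)
  then show ?thesis using j by linarith
qed

text \<open>A codeword \<open>x\<close> owns the block from \<open>2 ^ j * Suc x\<close> to \<open>2 ^ j * (Suc x + 1)\<close>; extending the
  string shrinks the block, and the blocks of different events are disjoint.\<close>

lemma codeword_prefix_unique:
  assumes cw: "codeword E A (n + 3) x w j" and cw': "codeword E A (n + 3) x' w' j'"
    and fin: "finite {w. E w}" and card: "card {w. E w} \<le> 2 ^ Suc n"
    and "prefix (string_of_nat x) (string_of_nat x')"
  shows "w = w' \<and> x = x'"
proof -
  obtain s where s: "string_of_nat x' = string_of_nat x @ s" using assms(5) by (auto simp: prefix_def)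
  have j: "j = j' + length s"
    using codeword_length[OF cw fin card] codeword_length[OF cw' fin card] s by simp
  have "nat_of_string (string_of_nat x') = x * 2 ^ length s + nat_of_string s"
    unfolding s nat_of_string_append by simp
  then have "Suc x' + 2 ^ length s = Suc x * 2 ^ length s + Suc (nat_of_string s)" by simp
  then have "Suc x * 2 ^ length s \<le> Suc x'" "Suc x' < Suc x * 2 ^ length s + 2 ^ length s"
    using Suc_nat_of_string_bounds[of s] by simp_all
  then have "2 ^ j' * (Suc x * 2 ^ length s) \<le> 2 ^ j' * Suc x'"
    "2 ^ j' * Suc x' < 2 ^ j' * (Suc x * 2 ^ length s + 2 ^ length s)"
    by (simp_all only: mult_le_mono2 mult_less_cancel1) simp
  then have nested: "2 ^ j * Suc x \<le> 2 ^ j' * Suc x'" "2 ^ j' * Suc x' < 2 ^ j * Suc x + 2 ^ j"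
    unfolding j by (simp_all add: power_add algebra_simps)
  \<comment> \<open>By \<open>nested\<close> the block of \<open>x'\<close> starts inside that of
    \<open>x\<close>. Distinct events have reserved pieces that do not overlap and contain their
    blocks, so neither order of \<open>w\<close> and \<open>w'\<close> is possible.\<close>
  have "\<not> w < w'"
    using offset_codeword[OF cw, of w'] nested cw cw' unfolding codeword_def by linarith
  moreover have "\<not> w' < w"
    using offset_codeword[OF cw', of w] nested cw cw' unfolding codeword_def by linarith
  ultimately have w: "w = w'" by simp
  then have "(2::nat) ^ j = 2 ^ j'" using cw cw' by (simp add: codeword_def)
  then have "s = []" using j by simp
  then show ?thesis using w s by (metis append_Nil2 string_of_nat_inverse)
qed

lemma codeword_exists:
  assumes "E w" "Suc (event_count E A (A w) w) = 2 ^ j"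
  shows "\<exists>x. codeword E A N x w j"
proof -
  define m :: nat where "m = 2 ^ N + offset E A w"
  \<comment> \<open>This is \<open>m / 2 ^ j\<close> rounded up. It equals \<open>Suc x\<close>, so
    the codeword is \<open>X - 1\<close>.\<close>
  define X where "X = (m + 2 ^ j - 1) div 2 ^ j"
  have "m > 0" by (simp add: m_def)
  have "(m + 2 ^ j - 1) = 2 ^ j * X + (m + 2 ^ j - 1) mod 2 ^ j" by (simp add: X_def)
  moreover have "(m + 2 ^ j - 1) mod 2 ^ j < 2 ^ j" by simp
  ultimately have X: "m \<le> 2 ^ j * X" "2 ^ j * X < m + 2 ^ j" using \<open>m > 0\<close> by linarith+
  then have "X > 0" using \<open>m > 0\<close> by (cases X) auto
  then show ?thesis
    using X assms by (intro exI[of _ "X - 1"]) (simp add: codeword_def m_def)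
qed

section \<open>Recursiveness of the Cantor decoding\<close>

lemma recursive_prod_decode:
  assumes "recursive F"
  shows "recursive (\<lambda>e. fst (prod_decode (F e)))" "recursive (\<lambda>e. snd (prod_decode (F e)))"
proof -
  \<comment> \<open>Writing the triangular number as a sum avoids division.\<close>
  have triangle: "triangle n = (\<Sum>i<Suc n. i)" for n by (induction n) auto
  have encode: "decidable (\<lambda>e. prod_encode (G e, H e) = K e)"
    if "recursive G" "recursive H" "recursive K" for G H K
    unfolding prod_encode_def prod.case triangle
    by (intro decidable_eq recursive_add recursive_sum recursive_Suc recursive_proj that)
  \<comment> \<open>Decoding is a search for one component; the other is bounded because no
    component exceeds the code.\<close>
  have fst: "(LEAST m. \<exists>n<Suc x. prod_encode (m, n) = x) = fst (prod_decode x)" for x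
  proof (rule Least_equality)
    show "\<exists>n<Suc x. prod_encode (fst (prod_decode x), n) = x"
      using le_prod_encode_2[of "snd (prod_decode x)" "fst (prod_decode x)"]
      by (intro exI[of _ "snd (prod_decode x)"]) (simp add: less_Suc_eq_le)
  qed auto
  have snd: "(LEAST n. \<exists>m<Suc x. prod_encode (m, n) = x) = snd (prod_decode x)" for x
  proof (rule Least_equality)
    show "\<exists>m<Suc x. prod_encode (m, snd (prod_decode x)) = x"
      using le_prod_encode_1[of "fst (prod_decode x)" "snd (prod_decode x)"]
      by (intro exI[of _ "fst (prod_decode x)"]) (simp add: less_Suc_eq_le)
  qed auto
  have "\<exists>m n. n < Suc x \<and> prod_encode (m, n) = x" "\<exists>n m. m < Suc x \<and> prod_encode (m, n) = x" for x
    using fst snd le_prod_encode_1 le_prod_encode_2 less_Suc_eq_le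
    by (metis prod_decode_inverse surj_pair)+
  then have "recursive (\<lambda>e. LEAST m. \<exists>n<Suc (e 0). prod_encode (m, n) = e 0)"
    "recursive (\<lambda>e. LEAST n. \<exists>m<Suc (e 0). prod_encode (m, n) = e 0)"
    by (intro recursive_Least decidable_bex encode recursive_Suc recursive_proj; blast)+
  then have "recursive (\<lambda>e. fst (prod_decode (e 0)))" "recursive (\<lambda>e. snd (prod_decode (e 0)))"
    unfolding fst snd .
  from this[THEN recursive_subst1, OF assms]
  show "recursive (\<lambda>e. fst (prod_decode (F e)))" "recursive (\<lambda>e. snd (prod_decode (F e)))" .
qed

section \<open>The lower bound on the complexity of a pair\<close>

lemma pair_encoding_eq_iff:
  assumes "pair_encoding pair"
  shows "pair x y = pair x' y' \<longleftrightarrow> x = x' \<and> y = y'"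
  using assms injD[of "\<lambda>(x, y). pair x y" "(x, y)" "(x', y')"] by (auto simp: pair_encoding_def)

text \<open>An event \<open>w\<close> codes a time \<open>t\<close> together with \<open>a\<close>
  and \<open>b\<close>. Only the least time at which the pair is confirmed counts, so each pair
  yields one event; choosing a program of length at most \<open>n\<close> for each pair bounds their
  number. \<open>A\<close> and \<open>B\<close> do not depend on \<open>n\<close>, and
  \<open>E\<close> is decidable uniformly in \<open>n\<close>.\<close>

lemma enumerate_pairs_of_bounded_complexity:
  assumes U: "computable U" and pair: "pair_encoding pair"
  shows "\<exists>(E :: nat \<Rightarrow> nat \<Rightarrow> bool) (A :: nat \<Rightarrow> nat) (B :: nat \<Rightarrow> nat).
    decidable (\<lambda>e. E (e 0) (e 1)) \<and> recursive (\<lambda>e. A (e 0)) \<and> recursive (\<lambda>e. B (e 0)) \<and>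
    (\<forall>n. finite {w. E n w} \<and> card {w. E n w} \<le> 2 ^ Suc n) \<and>
    (\<forall>p a b n. U p = Some (pair a b) \<longrightarrow> length p \<le> n \<longrightarrow>
      (\<exists>w. E n w \<and> A w = nat_of_string a \<and> B w = nat_of_string b))"
proof -
  define pr where "pr x y = nat_of_string (pair (string_of_nat x) (string_of_nat y))" for x y
  have rec_pr: "recursive A \<Longrightarrow> recursive B \<Longrightarrow> recursive (\<lambda>e. pr (A e) (B e))" for A B
    using pair unfolding pair_encoding_def pr_def by (auto intro: recursive_pair)
  have pr_inj: "pr a b = pr a' b' \<longleftrightarrow> a = a' \<and> b = b'" for a b a' b'
    unfolding pr_def nat_of_string_eq_iff pair_encoding_eq_iff[OF pair] by simp
  \<comment> \<open>The inequality on \<open>x\<close> expresses that the program has length at most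
    \<open>n\<close>.\<close>
  define R where "R n a b \<longleftrightarrow>
    (\<exists>x. Suc x < 2 ^ Suc n \<and> U (string_of_nat x) = Some (string_of_nat (pr a b)))" for n a b
  have "semidecidable (\<lambda>e. R (e 0) (e 1) (e 2))"
    unfolding R_def
    by (intro semidecidable_ex semidecidable_conj semidecidable_decidable[OF decidable_less]
        semidecidable_computable[OF U] rec_pr recursive_power recursive_Suc recursive_proj
        recursive_const)
  then obtain Q where Q: "decidable (\<lambda>e. Q (e 0) (\<lambda>i. e (Suc i)))"
    and RQ: "\<forall>e. R (e 0) (e 1) (e 2) \<longleftrightarrow> (\<exists>w. Q w e)"
    unfolding semidecidable_def by blast
  \<comment> \<open>Entries beyond index 2 are fixed as well, so \<open>P\<close> depends on nothing
    but \<open>t\<close>, \<open>n\<close>, \<open>a\<close> and \<open>b\<close>.\<close>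
  define P where "P t n a b \<longleftrightarrow> Q t (\<lambda>i. if i = 0 then n else if i = 1 then a else b)" for t n a b
  have R_iff: "R n a b \<longleftrightarrow> (\<exists>t. P t n a b)" for n a b
    using RQ[rule_format, of "\<lambda>i. if i = 0 then n else if i = 1 then a else b"]
    unfolding P_def by simp
  have dec_P: "decidable (\<lambda>e. P (F e) (G e) (H e) (K e))"
    if "recursive F" "recursive G" "recursive H" "recursive K" for F G H K
    unfolding P_def
    by (rule decidable_env_subst[OF Q, where A =
          "\<lambda>i e. if i = 0 then G e else if i = 1 then H e else K e"])
      (intro that recursive_if decidable_const)+
  define A where "A w = fst (prod_decode (snd (prod_decode w)))" for w
  define B where "B w = snd (prod_decode (snd (prod_decode w)))" for w
  define T where "T w = fst (prod_decode w)" for w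
  have w_eqI: "w = w'" if "T w = T w'" "A w = A w'" "B w = B w'" for w w'
    using that unfolding T_def A_def B_def by (metis prod_eq_iff prod_decode_eq)
  define E where "E n w \<longleftrightarrow> P (T w) n (A w) (B w) \<and> (\<forall>s<T w. \<not> P s n (A w) (B w))" for n w
  show ?thesis
  proof (rule exI[of _ E], rule exI[of _ A], rule exI[of _ B], intro conjI allI impI)
    show "decidable (\<lambda>e. E (e 0) (e 1))"
      unfolding E_def A_def B_def T_def
      by (intro decidable_conj decidable_ball decidable_not dec_P recursive_prod_decode recursive_proj)
    show "recursive (\<lambda>e. A (e 0))" "recursive (\<lambda>e. B (e 0))"
      unfolding A_def B_def by (intro recursive_prod_decode recursive_proj)+
    fix n
    have "\<exists>x. Suc x < 2 ^ Suc n \<and> U (string_of_nat x) = Some (string_of_nat (pr (A w) (B w)))"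
      if "E n w" for w
      using that R_iff R_def unfolding E_def by blast
    then obtain g where g: "\<And>w. E n w \<Longrightarrow> Suc (g w) < 2 ^ Suc n \<and>
        U (string_of_nat (g w)) = Some (string_of_nat (pr (A w) (B w)))"
      by metis
    \<comment> \<open>A common program gives the same pair, and leastness of the confirmation time
      gives the same event.\<close>
    have inj: "inj_on g {w. E n w}"
    proof (rule inj_onI)
      fix w w' assume w: "w \<in> {w. E n w}" and w': "w' \<in> {w. E n w}" and "g w = g w'"
      then have "pr (A w) (B w) = pr (A w') (B w')"
        using g[of w] g[of w'] by simp
      then have AB: "A w = A w'" "B w = B w'" by (auto simp: pr_inj)
      moreover have "\<not> T w < T w'" "\<not> T w' < T w"
        using w w' AB by (auto simp: E_def)
      ultimately have "T w = T w'" by simp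
      then show "w = w'" using AB by (rule w_eqI)
    qed
    have sub: "g ` {w. E n w} \<subseteq> {..<2 ^ Suc n}" using g Suc_lessD by blast
    show "finite {w. E n w}" using inj sub by (meson finite_imageD finite_lessThan finite_subset)
    show "card {w. E n w} \<le> 2 ^ Suc n"
      using card_inj_on_le[OF inj sub] by simp
  next
    fix p a b n
    assume "U p = Some (pair a b)" "length p \<le> n"
    then have "R n (nat_of_string a) (nat_of_string b)"
      unfolding R_def by (intro exI[of _ "nat_of_string p"]) (simp add: pr_def length_le_iff)
    then have ex: "\<exists>t. P t n (nat_of_string a) (nat_of_string b)" by (simp add: R_iff)
    define t where "t = (LEAST t. P t n (nat_of_string a) (nat_of_string b))"
    have "P t n (nat_of_string a) (nat_of_string b)"
      "\<forall>s<t. \<not> P s n (nat_of_string a) (nat_of_string b)"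
      unfolding t_def using LeastI_ex[OF ex] not_less_Least by blast+
    then show "\<exists>w. E n w \<and> A w = nat_of_string a \<and> B w = nat_of_string b"
      by (intro exI[of _ "prod_encode (t, prod_encode (nat_of_string a, nat_of_string b))"])
        (simp add: E_def A_def B_def T_def)
  qed
qed

lemma complexity_pair_lower_bound:
  assumes U: "optimal_plain U" and W: "optimal_cond_plain W" and V: "optimal_cond_prefix V"
    and pair: "pair_encoding pair"
  obtains c where "\<And>a b n. complexity U (pair a b) \<le> n \<Longrightarrow>
    cond_complexity V a (string_of_nat n) + cond_complexity W b (pair a (string_of_nat n)) \<le> n + c"
proof -
  have comp_U: "computable U" using U by (simp add: optimal_plain_def)
  obtain E A B where dec_E: "decidable (\<lambda>e. E (e 0) (e 1))"
    and rec_A: "recursive (\<lambda>e. A (e 0))" and rec_B: "recursive (\<lambda>e. B (e 0))"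
    and fin_card: "\<forall>n. finite {w. E n w} \<and> card {w. E n w} \<le> 2 ^ Suc n"
    and enum: "\<forall>p a b n. U p = Some (pair a b) \<longrightarrow> length p \<le> n \<longrightarrow>
      (\<exists>w. E n w \<and> A w = nat_of_string a \<and> B w = nat_of_string b)"
    using enumerate_pairs_of_bounded_complexity[OF comp_U pair] by (elim exE conjE)
  have fin: "finite {w. E n w}" and card: "card {w. E n w} \<le> 2 ^ Suc n" for n
    using fin_card by blast+
  define pr where "pr x y = nat_of_string (pair (string_of_nat x) (string_of_nat y))" for x y
  have rec_pr: "recursive A \<Longrightarrow> recursive B \<Longrightarrow> recursive (\<lambda>e. pr (A e) (B e))" for A B
    using pair unfolding pair_encoding_def pr_def by (auto intro: recursive_pair)
  have pr_inj: "pr a b = pr a' b' \<longleftrightarrow> a = a' \<and> b = b'" for a b a' b'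
    unfolding pr_def nat_of_string_eq_iff pair_encoding_eq_iff[OF pair] by simp
  have E: "decidable (\<lambda>e. E (F e) (G e))" if "recursive F" "recursive G" for F G
    using decidable_subst[OF dec_E, of "\<lambda>i. if i = 0 then F else G"] that by simp
  note A = recursive_subst1[where h = A, OF rec_A] and B = recursive_subst1[where h = B, OF rec_B]
  have "recursive (\<lambda>e. event_count (E (e 0)) A (e 1) (e 2))"
    unfolding event_count_def
    by (intro recursive_sum recursive_if decidable_conj E decidable_eq A recursive_proj recursive_const)
  note count = recursive_subst3[where h = "\<lambda>n. event_count (E n) A", OF this]
  have "recursive (\<lambda>e. request (E (e 0)) A (e 1))"
    unfolding request_def Let_def
    by (intro recursive_if decidable_conj decidable_bex decidable_eq E A count recursive_power
        recursive_Suc recursive_proj recursive_const)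
  note request = recursive_subst2[where h = "\<lambda>n. request (E n) A", OF this]
  have "recursive (\<lambda>e. offset (E (e 0)) A (e 1))"
    unfolding offset_def
    by (intro recursive_sum recursive_mult request recursive_proj recursive_const)
  note offset = recursive_subst2[where h = "\<lambda>n. offset (E n) A", OF this]

  \<comment> \<open>Machine for \<open>b\<close>: the condition yields \<open>a\<close> and
    \<open>n\<close>, and the program is the index of an event among those of value
    \<open>a\<close>.\<close>
  define index where "index x v b \<longleftrightarrow> (\<exists>n w. v = pr (A w) n \<and> E n w \<and>
      event_count (E n) A (A w) w = x \<and> b = B w)" for x v b
  have semi_index: "semidecidable (\<lambda>e. index (e 0) (e 1) (e 2))"
    unfolding index_def
    by (intro semidecidable_ex semidecidable_decidable decidable_conj decidable_eq E rec_pr A B count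
        recursive_proj)
  have index_functional: "b = b'" if "index x v b" "index x v b'" for x v b b'
    using that unfolding index_def by (metis event_count_inject pr_inj)
  obtain M1 where M1: "computable2 M1" "\<And>p v u. M1 p v = Some u \<longleftrightarrow>
      index (nat_of_string p) (nat_of_string v) (nat_of_string u)"
    by (rule obtain_computable2[of index]) (use semi_index index_functional in blast)+
  obtain c1 where c1: "\<And>p v u. M1 p v = Some u \<Longrightarrow> \<exists>q. W q v = Some u \<and> length q \<le> length p + c1"
    using W M1(1) unfolding optimal_cond_plain_def by blast

  \<comment> \<open>Machine for \<open>a\<close>: under condition \<open>n\<close> the programs are
    the allocated codewords.\<close>
  define alloc where "alloc x n a \<longleftrightarrow> (\<exists>w j. codeword (E n) A (n + 3) x w j \<and> a = A w)" for x n a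
  have semi_alloc: "semidecidable (\<lambda>e. alloc (e 0) (e 1) (e 2))"
    unfolding alloc_def codeword_def
    by (intro semidecidable_ex semidecidable_decidable decidable_conj decidable_eq decidable_le
        decidable_less E A count offset recursive_add recursive_mult recursive_power recursive_Suc
        recursive_proj recursive_const)
  \<comment> \<open>As \<open>prefix\<close> is reflexive, uniqueness of codewords gives
    functionality here as well as prefix-freeness below.\<close>
  have alloc_functional: "a = a'" if "alloc x n a" "alloc x n a'" for x n a a'
    using that codeword_prefix_unique[OF _ _ fin card] unfolding alloc_def by blast
  obtain M2 where M2: "computable2 M2" "\<And>p v u. M2 p v = Some u \<longleftrightarrow>
      alloc (nat_of_string p) (nat_of_string v) (nat_of_string u)"
    by (rule obtain_computable2[of alloc]) (use semi_alloc alloc_functional in blast)+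
  have "prefix_free (dom (\<lambda>p. M2 p v))" for v
    unfolding prefix_free_def
  proof (intro ballI impI)
    fix p q assume "p \<in> dom (\<lambda>p. M2 p v)" "q \<in> dom (\<lambda>p. M2 p v)" and pq: "prefix p q"
    then obtain w j w' j' where
      "codeword (E (nat_of_string v)) A (nat_of_string v + 3) (nat_of_string p) w j"
      "codeword (E (nat_of_string v)) A (nat_of_string v + 3) (nat_of_string q) w' j'"
      by (auto simp: M2(2) alloc_def)
    from codeword_prefix_unique[OF this fin card] pq show "p = q"
      by (simp add: nat_of_string_eq_iff)
  qed
  then have "prefix_machine M2" using M2(1) by (simp add: prefix_machine_def)
  then obtain c2 where c2: "\<And>p v u. M2 p v = Some u \<Longrightarrow> \<exists>q. V q v = Some u \<and> length q \<le> length p + c2"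
    using V unfolding optimal_cond_prefix_def by blast

  show thesis
  proof (rule that[of "3 + c1 + c2"])
    fix a b n assume n: "complexity U (pair a b) \<le> n"
    obtain p where "U p = Some (pair a b)" "length p \<le> n"
      using complexity_attained[OF optimal_plain_has_program[OF U]] n by metis
    then obtain w where w: "E n w" "A w = nat_of_string a" "B w = nat_of_string b"
      using enum by blast
    \<comment> \<open>After stage \<open>s\<close> there are no more events, so
      \<open>?count s\<close> is the total number for \<open>a\<close>.\<close>
    obtain s where s: "\<forall>w\<in>{w. E n w}. w < s"
      using fin[of n] finite_nat_set_iff_bounded by blast
    let ?count = "event_count (E n) A (nat_of_string a)"
    have less: "?count w < ?count s" using w s by (intro event_count_strict_mono) auto
    then obtain l where l: "2 ^ l \<le> ?count s" "?count s < 2 ^ Suc l"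
      using power_of_two_interval[of "?count s"] by auto

    have "M1 (string_of_nat (?count w)) (pair a (string_of_nat n)) = Some b"
      unfolding M1(2) index_def using w
      by (intro exI[of _ n] exI[of _ w]) (simp add: pr_def)
    from c1[OF this] obtain q where "W q (pair a (string_of_nat n)) = Some b"
      "length q \<le> length (string_of_nat (?count w)) + c1" by blast
    \<comment> \<open>An index below the total satisfies
      \<open>Suc (?count w) \<le> ?count s < 2 ^ Suc l\<close>.\<close>
    moreover have "length (string_of_nat (?count w)) \<le> l"
      unfolding length_le_iff using less l by simp
    ultimately have W_le: "cond_complexity W b (pair a (string_of_nat n)) \<le> l + c1"
      using complexity_le[of "\<lambda>q. W q (pair a (string_of_nat n))" q b]
      unfolding cond_complexity_def by simp

    \<comment> \<open>The event \<open>w'\<close> that brings the count to \<open>2 ^ l\<close> may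
      differ from \<open>w\<close>; its codeword still describes \<open>a\<close> and has length
      \<open>n + 3 - l\<close>, so \<open>l\<close> cancels in the sum.\<close>
    have "(2::nat) ^ l - 1 < ?count s" using l less by simp
    then obtain w' where w': "E n w'" "A w' = nat_of_string a" "?count w' = 2 ^ l - 1"
      using event_count_attained by blast
    then have "Suc (event_count (E n) A (A w') w') = 2 ^ l" by simp
    then obtain x where x: "codeword (E n) A (n + 3) x w' l"
      using codeword_exists w'(1) by blast
    have "M2 (string_of_nat x) (string_of_nat n) = Some a"
      using x w'(2) unfolding M2(2) alloc_def string_of_nat_inverse by metis
    from c2[OF this] obtain r where "V r (string_of_nat n) = Some a"
      "length r \<le> length (string_of_nat x) + c2" by blast
    then have "cond_complexity V a (string_of_nat n) \<le> length (string_of_nat x) + c2"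
      using complexity_le[of "\<lambda>q. V q (string_of_nat n)" r a]
      unfolding cond_complexity_def by simp
    with W_le codeword_length[OF x fin card]
    show "cond_complexity V a (string_of_nat n) + cond_complexity W b (pair a (string_of_nat n)) \<le>
        n + (3 + c1 + c2)" by linarith
  qed
qed

theorem theorem1:
  fixes U :: "bool list \<Rightarrow> bool list option"
    and W V :: "bool list \<Rightarrow> bool list \<Rightarrow> bool list option"
    and pair :: "bool list \<Rightarrow> bool list \<Rightarrow> bool list"
  assumes "optimal_plain U"
    and "optimal_cond_plain W"
    and "optimal_cond_prefix V"
    and "pair_encoding pair"
  shows "\<exists>c::nat. \<forall>a b :: bool list.
    \<bar>int (complexity U (pair a b)) -
      (int (cond_complexity V a (string_of_nat (complexity U (pair a b)))) +
       int (cond_complexity W b (pair a (string_of_nat (complexity U (pair a b))))))\<bar> \<le> int c"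
proof -
  obtain c where c: "\<And>a b n. n = complexity U (pair a b) \<Longrightarrow>
    n \<le> cond_complexity V a (string_of_nat n) + cond_complexity W b (pair a (string_of_nat n)) + c"
    using complexity_pair_upper_bound[OF assms] by blast
  obtain c' where c': "\<And>a b n. complexity U (pair a b) \<le> n \<Longrightarrow>
    cond_complexity V a (string_of_nat n) + cond_complexity W b (pair a (string_of_nat n)) \<le> n + c'"
    using complexity_pair_lower_bound[OF assms] by blast
  show ?thesis
  proof (intro exI[of _ "c + c'"] allI)
    fix a b
    show "\<bar>int (complexity U (pair a b)) -
      (int (cond_complexity V a (string_of_nat (complexity U (pair a b)))) +
       int (cond_complexity W b (pair a (string_of_nat (complexity U (pair a b))))))\<bar> \<le> int (c + c')"
      using c[OF refl, of a b] c'[OF order_refl, of a b] by linarith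
  qed
qed

end
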